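(* In the value oracle model, there exist instances of the problem $\max\{f(S):S\in\mathcal{I}\}$, where $f$ is a nonnegative submodular function and $\mathcal{I}$ is the family of independent sets of a matroid, such that any $0.478$-approximation algorithm for these instances requires exponentially many value queries.
   Context: $f$ is submodular: $f(S\cup T)+f(S\cap T)\le f(S)+f(T)$; in the value oracle model the algorithm accesses $f$ only via queries returning $f(S)$. A $0.478$-approximation returns $S\in\mathcal{I}$ with $f(S)\ge0.478\max_{S'\in\mathcal{I}}f(S')$. *)

theory Defs
  imports "HOL-Probability.Probability"
begin

definition matroid :: "'a set \<Rightarrow> 'a set set \<Rightarrow> bool" where
  "matroid E \<I> \<longleftrightarrow>
     finite E \<and> \<I> \<subseteq> Pow E \<and> {} \<in> \<I> \<and>
     (\<forall>S T. T \<in> \<I> \<and> S \<subseteq> T \<longrightarrow> S \<in> \<I>) \<and>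
     (\<forall>S T. S \<in> \<I> \<and> T \<in> \<I> \<and> card S < card T \<longrightarrow> (\<exists>x \<in> T - S. insert x S \<in> \<I>))"

definition nonneg_on :: "'a set \<Rightarrow> ('a set \<Rightarrow> real) \<Rightarrow> bool" where
  "nonneg_on E f \<longleftrightarrow> (\<forall>S. S \<subseteq> E \<longrightarrow> 0 \<le> f S)"

definition submodular_on :: "'a set \<Rightarrow> ('a set \<Rightarrow> real) \<Rightarrow> bool" where
  "submodular_on E f \<longleftrightarrow>
     (\<forall>S T. S \<subseteq> E \<and> T \<subseteq> E \<longrightarrow> f (S \<union> T) + f (S \<inter> T) \<le> f S + f T)"

text \<open>
  A deterministic algorithm in the value oracle model is an adaptive query strategy:
  either it stops and returns a set, or it queries a set and continues depending on the real
  number the oracle returns. Computation between queries is unrestricted and not counted.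
\<close>

datatype 'a strategy =
    Return "'a set"
  | Query "'a set" "real \<Rightarrow> 'a strategy"

primrec result :: "('a set \<Rightarrow> real) \<Rightarrow> 'a strategy \<Rightarrow> 'a set" where
  "result f (Return S) = S"
| "result f (Query Q k) = result f (k (f Q))"

primrec num_queries :: "('a set \<Rightarrow> real) \<Rightarrow> 'a strategy \<Rightarrow> nat" where
  "num_queries f (Return S) = 0"
| "num_queries f (Query Q k) = Suc (num_queries f (k (f Q)))"

primrec queries_within :: "'a set \<Rightarrow> 'a strategy \<Rightarrow> bool" where
  "queries_within E (Return S) \<longleftrightarrow> True"
| "queries_within E (Query Q k) \<longleftrightarrow> Q \<subseteq> E \<and> (\<forall>r. queries_within E (k r))"

text \<open>
  A randomized algorithm for ground set \<open>E\<close> receives the matroid explicitly and draws a strategy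
  at random; only the objective function is hidden behind the oracle. Deterministic algorithms are
  the case of point distributions.
\<close>

type_synonym 'a oracle_alg = "'a set set \<Rightarrow> 'a strategy pmf"

definition oracle_algorithm :: "'a set \<Rightarrow> 'a oracle_alg \<Rightarrow> bool" where
  "oracle_algorithm E A \<longleftrightarrow>
     (\<forall>\<I>. matroid E \<I> \<longrightarrow> (\<forall>t \<in> set_pmf (A \<I>). queries_within E t))"

type_synonym 'a problem = "'a set set \<times> ('a set \<Rightarrow> real)"

definition submodular_matroid_instance :: "'a set \<Rightarrow> 'a problem \<Rightarrow> bool" where
  "submodular_matroid_instance E = (\<lambda>(\<I>, f). matroid E \<I> \<and> nonneg_on E f \<and> submodular_on E f)"

definition approx_solution :: "real \<Rightarrow> 'a problem \<Rightarrow> 'a set \<Rightarrow> bool" where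
  "approx_solution \<alpha> = (\<lambda>(\<I>, f) S. S \<in> \<I> \<and> \<alpha> * Max (f ` \<I>) \<le> f S)"

text \<open>
  For randomized algorithms there are two customary guarantees: an \<open>\<alpha>\<close>-approximate solution with
  probability at least \<open>p\<close>, or a feasible solution whose expected value is at least \<open>\<alpha>\<close> times the
  optimum. For a deterministic algorithm (and \<open>0 < p \<le> 1\<close>) both say that the returned set is an
  \<open>\<alpha>\<close>-approximate solution.
\<close>

definition approximates_with_prob ::
    "real \<Rightarrow> real \<Rightarrow> 'a oracle_alg \<Rightarrow> 'a problem \<Rightarrow> bool" where
  "approximates_with_prob p \<alpha> A = (\<lambda>(\<I>, f).
     p \<le> measure_pmf.prob (A \<I>) {t. approx_solution \<alpha> (\<I>, f) (result f t)})"

definition approximates_in_expectation ::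
    "real \<Rightarrow> 'a oracle_alg \<Rightarrow> 'a problem \<Rightarrow> bool" where
  "approximates_in_expectation \<alpha> A = (\<lambda>(\<I>, f).
     (\<forall>t \<in> set_pmf (A \<I>). result f t \<in> \<I>) \<and>
     \<alpha> * Max (f ` \<I>) \<le> measure_pmf.expectation (A \<I>) (\<lambda>t. f (result f t)))"

definition approximation_algorithm ::
    "real \<Rightarrow> real \<Rightarrow> 'a set \<Rightarrow> 'a problem set \<Rightarrow> 'a oracle_alg \<Rightarrow> bool" where
  "approximation_algorithm p \<alpha> E C A \<longleftrightarrow>
     oracle_algorithm E A \<and>
     ((\<forall>i \<in> C. approximates_with_prob p \<alpha> A i) \<or> (\<forall>i \<in> C. approximates_in_expectation \<alpha> A i))"

end

theory Submission imports Defs begin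

text \<open>
  The symmetry gap argument of Vondrak and Gharan. Split the ground set into \<open>m\<close> groups of
  \<open>2K + 2\<close> elements; in each group a secret cyclic shift tells which elements play the roles
  \<open>a\<^sub>1, \<dots>, a\<^sub>K, b\<^sub>1, \<dots>, b\<^sub>K, a, b\<close>. The hidden objective is a function of the fractions \<open>x i\<close> of
  groups whose element of role \<open>i\<close> is not in the set: the cut function of two directed hyperedges,
  with tails \<open>{a\<^sub>1, \<dots>, a\<^sub>K}\<close> and \<open>{b\<^sub>1, \<dots>, b\<^sub>K}\<close>, heads \<open>a\<close> and \<open>b\<close> and weight 7/20, and of an
  edge \<open>ab\<close> of weight 13/20. Under the constraint that at most \<open>m\<close> elements of the roles \<open>a\<^sub>i, b\<^sub>i\<close> are
  chosen, its optimum is 1, while its symmetrization over the shifts has optimum below 0.4777.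

  The two functions agree to first order at the points invariant under the symmetry. Hence they
  can be interpolated by a cutoff of the squared distance \<open>\<rho>\<close> to these points that varies slowly on
  the scale of \<open>ln \<rho>\<close>, so that all second partial derivatives keep the right sign up to a small
  quadratic correction. The interpolation is submodular, and it coincides with the symmetrization
  unless \<open>\<rho>\<close> exceeds a threshold, which for a fixed query happens only for an exponentially small
  fraction of the shifts.
\<close>

subsection \<open>Second partial derivatives and supermodularity\<close>

text \<open>Directional derivatives along all lines, linear in the direction. Points are plain
  sequences because the dimension depends on \<open>K\<close>, and one-variable calculus suffices.
  As \<open>u\<close> is arbitrary, \<open>f\<close> is constant in the coordinates from
  \<open>N\<close> on.\<close>

definition gradient :: "nat \<Rightarrow> ((nat \<Rightarrow> real) \<Rightarrow> real) \<Rightarrow> (nat \<Rightarrow> (nat \<Rightarrow> real) \<Rightarrow> real) \<Rightarrow> bool" where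
  "gradient N f D \<longleftrightarrow> (\<forall>x u. ((\<lambda>t. f (\<lambda>i. x i + t * u i)) has_real_derivative (\<Sum>i<N. u i * D i x)) (at 0))"

definition unit_cube :: "nat \<Rightarrow> (nat \<Rightarrow> real) set" where
  "unit_cube N = {x. \<forall>i<N. 0 \<le> x i \<and> x i \<le> 1}"

lemma gradientD:
  "gradient N f D \<Longrightarrow>
    ((\<lambda>t. f (\<lambda>i. x i + t * u i)) has_real_derivative (\<Sum>i<N. u i * D i x)) (at 0)"
  by (simp add: gradient_def)

lemma gradient_along_line:
  assumes "gradient N f D"
  shows "((\<lambda>t. f (\<lambda>i. x i + t * u i)) has_real_derivative (\<Sum>i<N. u i * D i (\<lambda>i. x i + t * u i))) (at t)"
proof -
  have "((\<lambda>s. f (\<lambda>i. (x i + t * u i) + s * u i)) has_real_derivative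
      (\<Sum>i<N. u i * D i (\<lambda>i. x i + t * u i))) (at 0)"
    by (rule gradientD[OF assms])
  then have "((\<lambda>s. f (\<lambda>i. x i + (s + t) * u i)) has_real_derivative
      (\<Sum>i<N. u i * D i (\<lambda>i. x i + t * u i))) (at 0)"
    by (simp add: algebra_simps)
  then show ?thesis
    using DERIV_shift[of "\<lambda>t. f (\<lambda>i. x i + t * u i)" _ 0 t] by simp
qed

lemma gradient_const: "gradient N (\<lambda>x. c) (\<lambda>i x. 0)"
  by (simp add: gradient_def)

lemma gradient_coord:
  assumes "k < N"
  shows "gradient N (\<lambda>x. x k) (\<lambda>i x. if i = k then 1 else 0)"
proof -
  have "(\<Sum>i<N. u i * (if i = k then 1 else 0)) = u k" for u :: "nat \<Rightarrow> real"
    using assms by (simp add: if_distrib cong: if_cong)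
  then show ?thesis
    unfolding gradient_def by (auto intro!: derivative_eq_intros)
qed

lemma gradient_add:
  assumes "gradient N f D" "gradient N g E"
  shows "gradient N (\<lambda>x. f x + g x) (\<lambda>i x. D i x + E i x)"
  using assms unfolding gradient_def
  by (auto intro!: derivative_eq_intros simp: distrib_left sum.distrib)

lemma gradient_diff:
  assumes "gradient N f D" "gradient N g E"
  shows "gradient N (\<lambda>x. f x - g x) (\<lambda>i x. D i x - E i x)"
  using assms unfolding gradient_def
  by (auto intro!: derivative_eq_intros simp: right_diff_distrib sum_subtractf)

lemma gradient_mult:
  assumes "gradient N f D" "gradient N g E"
  shows "gradient N (\<lambda>x. f x * g x) (\<lambda>i x. D i x * g x + f x * E i x)"
  unfolding gradient_def
proof (intro allI)
  fix x u
  have "((\<lambda>t. f (\<lambda>i. x i + t * u i) * g (\<lambda>i. x i + t * u i)) has_real_derivative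
     (\<Sum>i<N. u i * D i x) * g (\<lambda>i. x i + 0 * u i) + (\<Sum>i<N. u i * E i x) * f (\<lambda>i. x i + 0 * u i)) (at 0)"
    using assms unfolding gradient_def by (intro DERIV_mult) auto
  then show "((\<lambda>t. f (\<lambda>i. x i + t * u i) * g (\<lambda>i. x i + t * u i)) has_real_derivative
     (\<Sum>i<N. u i * (D i x * g x + f x * E i x))) (at 0)"
    by (simp add: algebra_simps sum.distrib sum_distrib_left sum_distrib_right)
qed

lemma gradient_compose:
  assumes "gradient N f D" and h: "\<And>y. (h has_real_derivative h' y) (at y)"
  shows "gradient N (\<lambda>x. h (f x)) (\<lambda>i x. h' (f x) * D i x)"
  unfolding gradient_def
proof (intro allI)
  fix x u
  have "((\<lambda>t. f (\<lambda>i. x i + t * u i)) has_real_derivative (\<Sum>i<N. u i * D i x)) (at 0)"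
    using assms(1) unfolding gradient_def by blast
  from DERIV_chain2[OF h this]
  show "((\<lambda>t. h (f (\<lambda>i. x i + t * u i))) has_real_derivative (\<Sum>i<N. u i * (h' (f x) * D i x))) (at 0)"
    by (simp add: algebra_simps sum_distrib_left)
qed

lemma gradient_partial:
  assumes "gradient N f D" "k < N"
  shows "((\<lambda>t. f (\<lambda>i. x i + (if i = k then t else 0))) has_real_derivative D k x) (at 0)"
proof -
  have "((\<lambda>t. f (\<lambda>i. x i + t * (if i = k then 1 else 0))) has_real_derivative
      (\<Sum>i<N. (if i = k then 1 else 0) * D i x)) (at 0)"
    by (rule gradientD[OF assms(1)])
  moreover have "(\<Sum>i<N. (if i = k then 1 else 0) * D i x) = D k x"
    using assms(2) by (simp add: if_distrib[of "\<lambda>z. z * _"] cong: if_cong)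
  moreover have "(\<lambda>t. f (\<lambda>i. x i + t * (if i = k then 1 else 0))) = (\<lambda>t. f (\<lambda>i. x i + (if i = k then t else 0)))"
    by (rule ext, rule arg_cong[of _ _ f], rule ext) auto
  ultimately show ?thesis by simp
qed

text \<open>The sign of the Hessian is integrated twice: each \<open>D i\<close> grows in the
  direction \<open>v\<close>, so the increment of \<open>f\<close> by \<open>v\<close> grows along
  \<open>u\<close>. A linear function minus such an \<open>f\<close> is submodular.\<close>

lemma supermodular_of_hessian_nonneg:
  assumes D: "gradient N f D" and H: "\<And>i. i < N \<Longrightarrow> gradient N (D i) (H i)"
    and nn: "\<And>x i j. x \<in> unit_cube N \<Longrightarrow> i < N \<Longrightarrow> j < N \<Longrightarrow> 0 \<le> H i j x"
    and cube: "x \<in> unit_cube N" "(\<lambda>i. x i + u i + v i) \<in> unit_cube N"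
    and u: "\<And>i. i < N \<Longrightarrow> 0 \<le> u i" and v: "\<And>i. i < N \<Longrightarrow> 0 \<le> v i"
  shows "f (\<lambda>i. x i + u i) + f (\<lambda>i. x i + v i) \<le> f x + f (\<lambda>i. x i + u i + v i)"
proof -
  have in_cube: "(\<lambda>i. x i + t * u i + s * v i) \<in> unit_cube N" if "0 \<le> t" "t \<le> 1" "0 \<le> s" "s \<le> 1" for s t
    unfolding unit_cube_def
  proof (intro CollectI allI impI conjI)
    fix i assume i: "i < N"
    have "0 \<le> x i" "x i + u i + v i \<le> 1" using cube i by (auto simp: unit_cube_def)
    moreover have "0 \<le> t * u i" "t * u i \<le> u i" using that u[OF i] by (auto simp: mult_left_le_one_le)
    moreover have "0 \<le> s * v i" "s * v i \<le> v i" using that v[OF i] by (auto simp: mult_left_le_one_le)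
    ultimately show "0 \<le> x i + t * u i + s * v i" "x i + t * u i + s * v i \<le> 1" by linarith+
  qed
  have mono: "D i (\<lambda>i. x i + t * u i + 0 * v i) \<le> D i (\<lambda>i. x i + t * u i + 1 * v i)"
    if i: "i < N" and t: "0 \<le> t" "t \<le> 1" for i t
  proof (rule DERIV_nonneg_imp_nondecreasing[where f = "\<lambda>s. D i (\<lambda>i. x i + t * u i + s * v i)"])
    fix s :: real assume s: "0 \<le> s" "s \<le> 1"
    have "0 \<le> (\<Sum>j<N. v j * H i j (\<lambda>i. x i + t * u i + s * v i))"
      using nn[OF in_cube[OF t s] i] v by (intro sum_nonneg mult_nonneg_nonneg) auto
    then show "\<exists>y. ((\<lambda>s. D i (\<lambda>i. x i + t * u i + s * v i)) has_real_derivative y) (at s) \<and> 0 \<le> y"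
      using gradient_along_line[OF H[OF i], of "\<lambda>i. x i + t * u i" v s] by blast
  qed simp
  let ?p = "\<lambda>t. f (\<lambda>i. (x i + v i) + t * u i) - f (\<lambda>i. x i + t * u i)"
  have "?p 0 \<le> ?p 1"
  proof (rule DERIV_nonneg_imp_nondecreasing[where f = ?p])
    fix t :: real assume t: "0 \<le> t" "t \<le> 1"
    have "(?p has_real_derivative (\<Sum>i<N. u i * D i (\<lambda>i. (x i + v i) + t * u i))
        - (\<Sum>i<N. u i * D i (\<lambda>i. x i + t * u i))) (at t)"
      by (intro DERIV_diff gradient_along_line D)
    moreover have "(\<Sum>i<N. u i * D i (\<lambda>i. x i + t * u i)) \<le> (\<Sum>i<N. u i * D i (\<lambda>i. (x i + v i) + t * u i))"
      using mono[OF _ t] u by (intro sum_mono mult_left_mono) (auto simp: algebra_simps)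
    ultimately show "\<exists>y. (?p has_real_derivative y) (at t) \<and> 0 \<le> y"
      by (meson diff_ge_0_iff_ge)
  qed simp
  then show ?thesis by (simp add: algebra_simps)
qed

text \<open>
  Satisfied by polynomials with nonnegative coefficients; asking for nonnegativity of the value and
  the gradient as well is what makes it closed under products.
\<close>

definition nonneg_C2 where
  "nonneg_C2 N f D H \<longleftrightarrow> gradient N f D \<and> (\<forall>i<N. gradient N (D i) (H i)) \<and>
     (\<exists>C. \<forall>x\<in>unit_cube N. 0 \<le> f x \<and> f x \<le> C \<and>
       (\<forall>i<N. 0 \<le> D i x \<and> D i x \<le> C \<and> (\<forall>j<N. 0 \<le> H i j x \<and> H i j x \<le> C)))"

definition monotone_poly :: "nat \<Rightarrow> ((nat \<Rightarrow> real) \<Rightarrow> real) \<Rightarrow> bool" where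
  "monotone_poly N f \<longleftrightarrow> (\<exists>D H. nonneg_C2 N f D H)"

lemma monotone_poly_const: "0 \<le> c \<Longrightarrow> monotone_poly N (\<lambda>x. c)"
  unfolding monotone_poly_def nonneg_C2_def
  by (rule exI[of _ "\<lambda>i x. 0"], rule exI[of _ "\<lambda>i j x. 0"]) (auto intro: gradient_const exI[of _ c])

lemma monotone_poly_coord:
  assumes "k < N" shows "monotone_poly N (\<lambda>x. x k)"
  unfolding monotone_poly_def nonneg_C2_def
  using assms
  by (intro exI[of _ "\<lambda>i x. if i = k then 1 else 0"] exI[of _ "\<lambda>i j x. 0"])
    (auto intro: gradient_const gradient_coord exI[of _ 1] simp: unit_cube_def)

lemma monotone_poly_add:
  assumes "monotone_poly N f" "monotone_poly N g"
  shows "monotone_poly N (\<lambda>x. f x + g x)"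
proof -
  obtain D H where DH: "nonneg_C2 N f D H" using assms(1) by (auto simp: monotone_poly_def)
  obtain E J where EJ: "nonneg_C2 N g E J" using assms(2) by (auto simp: monotone_poly_def)
  obtain B where B: "\<forall>x\<in>unit_cube N. 0 \<le> f x \<and> f x \<le> B \<and>
       (\<forall>i<N. 0 \<le> D i x \<and> D i x \<le> B \<and> (\<forall>j<N. 0 \<le> H i j x \<and> H i j x \<le> B))"
    using DH unfolding nonneg_C2_def by blast
  obtain C where C: "\<forall>x\<in>unit_cube N. 0 \<le> g x \<and> g x \<le> C \<and>
       (\<forall>i<N. 0 \<le> E i x \<and> E i x \<le> C \<and> (\<forall>j<N. 0 \<le> J i j x \<and> J i j x \<le> C))"
    using EJ unfolding nonneg_C2_def by blast
  have "nonneg_C2 N (\<lambda>x. f x + g x) (\<lambda>i x. D i x + E i x) (\<lambda>i j x. H i j x + J i j x)"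
    using DH EJ B C unfolding nonneg_C2_def
    by (auto intro!: gradient_add exI[of _ "B + C"] add_mono)
  then show ?thesis by (auto simp: monotone_poly_def)
qed

lemma monotone_poly_mult:
  assumes "monotone_poly N f" "monotone_poly N g"
  shows "monotone_poly N (\<lambda>x. f x * g x)"
proof -
  obtain D H where DH: "nonneg_C2 N f D H" using assms(1) by (auto simp: monotone_poly_def)
  obtain E J where EJ: "nonneg_C2 N g E J" using assms(2) by (auto simp: monotone_poly_def)
  obtain B where B: "\<forall>x\<in>unit_cube N. 0 \<le> f x \<and> f x \<le> B \<and>
       (\<forall>i<N. 0 \<le> D i x \<and> D i x \<le> B \<and> (\<forall>j<N. 0 \<le> H i j x \<and> H i j x \<le> B))"
    using DH unfolding nonneg_C2_def by blast
  obtain C where C: "\<forall>x\<in>unit_cube N. 0 \<le> g x \<and> g x \<le> C \<and>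
       (\<forall>i<N. 0 \<le> E i x \<and> E i x \<le> C \<and> (\<forall>j<N. 0 \<le> J i j x \<and> J i j x \<le> C))"
    using EJ unfolding nonneg_C2_def by blast
  let ?D = "\<lambda>i x. D i x * g x + f x * E i x"
  let ?H = "\<lambda>i j x. (H i j x * g x + D i x * E j x) + (D j x * E i x + f x * J i j x)"
  \<comment> \<open>The factor 4: a second partial derivative of a product is a sum of four
    products, each at most \<open>B * C\<close>, and a single constant has to bound
    everything.\<close>
  have "0 \<le> f x * g x \<and> f x * g x \<le> 4 * (B * C) \<and>
       (\<forall>i<N. 0 \<le> ?D i x \<and> ?D i x \<le> 4 * (B * C) \<and> (\<forall>j<N. 0 \<le> ?H i j x \<and> ?H i j x \<le> 4 * (B * C)))"
    if x: "x \<in> unit_cube N" for x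
  proof -
    note b = B[rule_format, OF x] and c = C[rule_format, OF x]
    have BC: "0 \<le> B" "0 \<le> C" "0 \<le> B * C" using b c by (auto intro: order_trans mult_nonneg_nonneg)
    have m: "0 \<le> y * z \<and> y * z \<le> B * C" if "0 \<le> y \<and> y \<le> B" "0 \<le> z \<and> z \<le> C" for y z :: real
      using that BC by (auto intro: mult_mono)
    have "0 \<le> f x * g x \<and> f x * g x \<le> B * C" using b c by (intro m) auto
    moreover have "0 \<le> D i x * g x \<and> D i x * g x \<le> B * C" if "i < N" for i using b c that by (intro m) auto
    moreover have "0 \<le> f x * E i x \<and> f x * E i x \<le> B * C" if "i < N" for i using b c that by (intro m) auto
    moreover have "0 \<le> H i j x * g x \<and> H i j x * g x \<le> B * C" if "i < N" "j < N" for i j using b c that by (intro m) auto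
    moreover have "0 \<le> D i x * E j x \<and> D i x * E j x \<le> B * C" if "i < N" "j < N" for i j using b c that by (intro m) auto
    moreover have "0 \<le> f x * J i j x \<and> f x * J i j x \<le> B * C" if "i < N" "j < N" for i j using b c that by (intro m) auto
    ultimately show ?thesis using BC by (smt (verit, best))
  qed
  moreover have "gradient N (\<lambda>x. f x * g x) ?D"
    using DH EJ unfolding nonneg_C2_def by (intro gradient_mult) auto
  moreover have "gradient N (?D i) (?H i)" if "i < N" for i
    using DH EJ that unfolding nonneg_C2_def by (intro gradient_add gradient_mult) auto
  ultimately have "nonneg_C2 N (\<lambda>x. f x * g x) ?D ?H"
    unfolding nonneg_C2_def by blast
  then show ?thesis by (auto simp: monotone_poly_def)
qed

lemma monotone_poly_sum:
  assumes "finite A" "\<And>k. k \<in> A \<Longrightarrow> monotone_poly N (f k)"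
  shows "monotone_poly N (\<lambda>x. \<Sum>k\<in>A. f k x)"
  using assms by (induction A rule: finite_induct) (auto intro: monotone_poly_const monotone_poly_add)

lemma monotone_poly_prod:
  assumes "finite A" "\<And>k. k \<in> A \<Longrightarrow> monotone_poly N (f k)"
  shows "monotone_poly N (\<lambda>x. \<Prod>k\<in>A. f k x)"
  using assms by (induction A rule: finite_induct) (auto intro: monotone_poly_const monotone_poly_mult)

lemma monotone_poly_power: "monotone_poly N f \<Longrightarrow> monotone_poly N (\<lambda>x. f x ^ k)"
  by (induction k) (auto intro: monotone_poly_const monotone_poly_mult)

section \<open>Taylor estimates on the cube\<close>

lemma gradient_increment_bound:
  assumes f: "gradient N f D"
    and B: "\<And>t i. 0 \<le> t \<Longrightarrow> t \<le> 1 \<Longrightarrow> i < N \<Longrightarrow> \<bar>D i (\<lambda>i. y i + t * (x i - y i))\<bar> \<le> B"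
    and d: "\<And>i. i < N \<Longrightarrow> \<bar>x i - y i\<bar> \<le> d" and "0 \<le> d"
  shows "\<bar>f x - f y\<bar> \<le> real N * (d * B)"
proof -
  let ?p = "\<lambda>t. f (\<lambda>i. y i + t * (x i - y i))"
  let ?q = "\<lambda>t. \<Sum>i<N. (x i - y i) * D i (\<lambda>i. y i + t * (x i - y i))"
  have "\<exists>z::real. 0 < z \<and> z < 1 \<and> ?p 1 - ?p 0 = (1 - 0) * ?q z"
    by (rule MVT2) (auto intro: gradient_along_line[OF f])
  then obtain z where z: "0 < z" "z < 1" "?p 1 - ?p 0 = ?q z" by auto
  have "\<bar>?q z\<bar> \<le> (\<Sum>i<N. \<bar>(x i - y i) * D i (\<lambda>i. y i + z * (x i - y i))\<bar>)"
    by (rule sum_abs)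
  also have "\<dots> \<le> (\<Sum>i<N. d * B)"
    unfolding abs_mult using z B d \<open>0 \<le> d\<close> by (intro sum_mono mult_mono) auto
  finally show ?thesis using z by simp
qed

lemma unit_cube_segment:
  assumes "x \<in> unit_cube N" "y \<in> unit_cube N" "0 \<le> t" "t \<le> 1"
  shows "(\<lambda>i. y i + t * (x i - y i)) \<in> unit_cube N"
  unfolding unit_cube_def
proof (intro CollectI allI impI)
  fix i assume "i < N"
  then have "0 \<le> x i" "x i \<le> 1" "0 \<le> y i" "y i \<le> 1" using assms by (auto simp: unit_cube_def)
  then have "0 \<le> (1 - t) * y i + t * x i" "(1 - t) * y i + t * x i \<le> 1"
    using assms convex_bound_le[of "y i" 1 "x i" "1 - t" t] by auto
  then show "0 \<le> y i + t * (x i - y i) \<and> y i + t * (x i - y i) \<le> 1" by (simp add: algebra_simps)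
qed

text \<open>The mean value theorem on the segment from \<open>y\<close> to \<open>x\<close>, applied
  first to \<open>D i\<close> and then to \<open>h\<close>, gives the Taylor estimate at a point
  where value and gradient vanish.\<close>

lemma second_order_bound:
  assumes h: "gradient N h D" and H: "\<And>i. i < N \<Longrightarrow> gradient N (D i) (H i)"
    and C: "\<And>x i j. x \<in> unit_cube N \<Longrightarrow> i < N \<Longrightarrow> j < N \<Longrightarrow> \<bar>H i j x\<bar> \<le> C"
    and xy: "x \<in> unit_cube N" "y \<in> unit_cube N"
    and y0: "h y = 0" "\<And>i. i < N \<Longrightarrow> D i y = 0"
    and d: "\<And>i. i < N \<Longrightarrow> \<bar>x i - y i\<bar> \<le> d" and "0 \<le> d"
  shows "\<bar>h x\<bar> \<le> real N * real N * C * d^2"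
    and "\<And>i. i < N \<Longrightarrow> \<bar>D i x\<bar> \<le> real N * C * d"
proof -
  \<comment> \<open>The gradient is bounded on the whole segment, because the mean value theorem for
    \<open>h\<close> evaluates it at an unknown point.\<close>
  have D: "\<bar>D i (\<lambda>i. y i + t * (x i - y i))\<bar> \<le> real N * (d * C)" if "i < N" "0 \<le> t" "t \<le> 1" for i t
  proof -
    let ?z = "\<lambda>i. y i + t * (x i - y i)"
    have z: "?z \<in> unit_cube N" using that xy by (intro unit_cube_segment) auto
    have "\<bar>D i ?z - D i y\<bar> \<le> real N * (d * C)"
    proof (rule gradient_increment_bound[OF H[OF that(1)]])
      show "\<bar>H i j (\<lambda>i. y i + s * (?z i - y i))\<bar> \<le> C" if "0 \<le> s" "s \<le> 1" "j < N" for s j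
        using C[OF unit_cube_segment[OF z xy(2)]] that \<open>i < N\<close> by blast
      fix j assume j: "j < N"
      have "\<bar>?z j - y j\<bar> = t * \<bar>x j - y j\<bar>" using that by (simp add: abs_mult)
      also have "\<dots> \<le> \<bar>x j - y j\<bar>" using that by (simp add: mult_left_le_one_le)
      finally show "\<bar>?z j - y j\<bar> \<le> d" using d[OF j] by linarith
    qed fact
    then show ?thesis using y0(2)[OF that(1)] by simp
  qed
  have "\<bar>h x - h y\<bar> \<le> real N * (d * (real N * (d * C)))"
    by (rule gradient_increment_bound[OF h]) (use D d \<open>0 \<le> d\<close> in auto)
  then show "\<bar>h x\<bar> \<le> real N * real N * C * d^2" using y0 by (simp add: power2_eq_square algebra_simps)
  show "\<bar>D i x\<bar> \<le> real N * C * d" if "i < N" for i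
    using D[OF that, of 1] by (simp add: algebra_simps)
qed

subsection \<open>Interpolation with a slowly varying cutoff\<close>

text \<open>
  The cube makes the glued function twice differentiable at \<open>r\<close>; the small exponent \<open>k\<close> makes
  \<open>y * cutoff' y\<close> and \<open>y\<^sup>2 * cutoff'' y\<close> of order \<open>k\<close>, uniformly in \<open>r\<close>.
\<close>

definition cutoff :: "real \<Rightarrow> real \<Rightarrow> real \<Rightarrow> real" where
  "cutoff k r y = (if y \<le> r then 0 else (1 - (r / y) powr k) ^ 3)"

definition cutoff' :: "real \<Rightarrow> real \<Rightarrow> real \<Rightarrow> real" where
  "cutoff' k r y = (if y \<le> r then 0 else 3 * (1 - (r / y) powr k)^2 * (k * (r / y) powr k / y))"

definition cutoff'' :: "real \<Rightarrow> real \<Rightarrow> real \<Rightarrow> real" where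
  "cutoff'' k r y = (if y \<le> r then 0 else
     (6 * (1 - (r / y) powr k) * (k * (r / y) powr k)^2
       - 3 * (1 - (r / y) powr k)^2 * (k * (k + 1) * (r / y) powr k)) / y^2)"

text \<open>At \<open>r\<close> the left difference quotient is 0 and the right one tends to
  \<open>g' r = 0\<close>. The cube in \<open>cutoff\<close> provides this double vanishing for
  \<open>cutoff\<close> and once more for \<open>cutoff'\<close>.\<close>

lemma DERIV_glue_zero:
  fixes g :: "real \<Rightarrow> real"
  assumes g: "\<And>y. r \<le> y \<Longrightarrow> (g has_real_derivative g' y) (at y)" and "g r = 0" "g' r = 0"
  shows "((\<lambda>y. if y \<le> r then 0 else g y) has_real_derivative (if y \<le> r then 0 else g' y)) (at y)"
proof -
  let ?f = "\<lambda>y. if y \<le> r then 0 else g y"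
  consider "y < r" | "y = r" | "y > r" by linarith
  then show ?thesis
  proof cases
    case 1
    have "((\<lambda>y. 0) has_real_derivative 0) (at y)" by simp
    then have "(?f has_real_derivative 0) (at y)"
      by (rule has_field_derivative_transform_within_open[where S = "{..<r}"]) (use 1 in auto)
    then show ?thesis using 1 by simp
  next
    case 3
    have "(g has_real_derivative g' y) (at y)" using 3 by (intro g) simp
    then have "(?f has_real_derivative g' y) (at y)"
      by (rule has_field_derivative_transform_within_open[where S = "{r<..}"]) (use 3 in auto)
    then show ?thesis using 3 by simp
  next
    case 2
    have "((\<lambda>y. (g y - g r) / (y - r)) \<longlongrightarrow> 0) (at r)"
      using g[of r] assms(3) by (simp add: has_field_derivative_iff)
    then have "((\<lambda>y. (g y - g r) / (y - r)) \<longlongrightarrow> 0) (at_right r)"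
      by (simp add: filterlim_at_split)
    moreover have "eventually (\<lambda>y. (g y - g r) / (y - r) = (?f y - ?f r) / (y - r)) (at_right r)"
      unfolding eventually_at_right_field using assms(2) by (intro exI[of _ "r + 1"]) auto
    ultimately have R: "((\<lambda>y. (?f y - ?f r) / (y - r)) \<longlongrightarrow> 0) (at_right r)"
      by (rule Lim_transform_eventually)
    have "eventually (\<lambda>y. 0 = (?f y - ?f r) / (y - r)) (at_left r)"
      unfolding eventually_at_left_field by (intro exI[of _ "r - 1"]) auto
    then have L: "((\<lambda>y. (?f y - ?f r) / (y - r)) \<longlongrightarrow> 0) (at_left r)"
      by (rule Lim_transform_eventually[OF tendsto_const])
    have "((\<lambda>y. (?f y - ?f r) / (y - r)) \<longlongrightarrow> 0) (at r)"
      using L R by (simp only: filterlim_at_split)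
    then show ?thesis using 2 by (simp add: has_field_derivative_iff)
  qed
qed

lemma DERIV_reciprocal_powr:
  fixes r y :: real
  assumes "0 < r" "0 < y"
  shows "((\<lambda>y. (r / y) powr k) has_real_derivative - (k * (r / y) powr k / y)) (at y)"
proof -
  have "((\<lambda>y. exp (k * (ln r - ln y))) has_real_derivative - (k * exp (k * (ln r - ln y)) / y)) (at y)"
    using assms by (auto intro!: derivative_eq_intros)
  then have "((\<lambda>y. (r / y) powr k) has_real_derivative - (k * exp (k * (ln r - ln y)) / y)) (at y)"
    by (rule has_field_derivative_transform_within_open[where S = "{0<..}"])
      (use assms in \<open>auto simp: powr_def ln_div\<close>)
  then show ?thesis using assms by (simp add: powr_def ln_div)
qed

text \<open>Of \<open>(r / y) powr k\<close> only the equation \<open>q' = - (k * q / y)\<close>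
  matters, which keeps real powers out of the calculation.\<close>

lemma DERIV_cutoff_aux:
  fixes q :: "real \<Rightarrow> real"
  assumes q: "(q has_real_derivative - (k * q y / y)) (at y)" and y: "0 < y"
  shows "((\<lambda>y. (1 - q y) ^ 3) has_real_derivative 3 * (1 - q y)^2 * (k * q y / y)) (at y)"
    and "((\<lambda>y. 3 * (1 - q y)^2 * (k * q y / y)) has_real_derivative
      (6 * (1 - q y) * (k * q y)^2 - 3 * (1 - q y)^2 * (k * (k + 1) * q y)) / y^2) (at y)"
  using y by (auto intro!: derivative_eq_intros q simp: field_simps power2_eq_square)

lemma DERIV_cutoff:
  assumes "0 < r" shows "(cutoff k r has_real_derivative cutoff' k r y) (at y)"
proof -
  have "((\<lambda>y. (1 - (r / y) powr k) ^ 3) has_real_derivative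
      3 * (1 - (r / y) powr k)^2 * (k * (r / y) powr k / y)) (at y)" if "r \<le> y" for y
    using that assms by (intro DERIV_cutoff_aux(1) DERIV_reciprocal_powr) auto
  then show ?thesis
    unfolding cutoff_def[abs_def] cutoff'_def by (rule DERIV_glue_zero) (use assms in simp_all)
qed

lemma DERIV_cutoff':
  assumes "0 < r" shows "(cutoff' k r has_real_derivative cutoff'' k r y) (at y)"
proof -
  have "((\<lambda>y. 3 * (1 - (r / y) powr k)^2 * (k * (r / y) powr k / y)) has_real_derivative
      (6 * (1 - (r / y) powr k) * (k * (r / y) powr k)^2
       - 3 * (1 - (r / y) powr k)^2 * (k * (k + 1) * (r / y) powr k)) / y^2) (at y)" if "r \<le> y" for y
    using that assms by (intro DERIV_cutoff_aux(2) DERIV_reciprocal_powr) auto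
  then show ?thesis
    unfolding cutoff'_def[abs_def] cutoff''_def by (rule DERIV_glue_zero) (use assms in simp_all)
qed

lemma ratio_powr_bounds:
  assumes "0 < r" "r < y" "0 < (k::real)"
  shows "0 < (r / y) powr k" "(r / y) powr k \<le> 1"
  using assms by (auto intro!: powr_le1)

lemma cutoff_bounds:
  assumes "0 < r" "0 < k"
  shows "0 \<le> cutoff k r y" "cutoff k r y \<le> 1"
  using ratio_powr_bounds[of r y k] assms
  by (auto simp: cutoff_def intro!: power_le_one zero_le_power)

text \<open>The factor \<open>1 / y\<close> cancels, and \<open>3 * k\<close> times a polynomial in
  \<open>q\<close> with values in [0, 1] remains, wherever \<open>r\<close> lies.\<close>

lemma cutoff'_bound:
  assumes "0 < r" "0 < k" "0 \<le> y"
  shows "\<bar>cutoff' k r y\<bar> * y \<le> 3 * k"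
proof (cases "y \<le> r")
  case False
  define q where "q = (r / y) powr k"
  have q: "0 < q" "q \<le> 1" using ratio_powr_bounds[of r y k] assms False by (auto simp: q_def)
  have "\<bar>cutoff' k r y\<bar> * y = 3 * k * ((1 - q)^2 * q)"
    using False assms q by (simp add: cutoff'_def q_def[symmetric] abs_mult)
  also have "(1 - q)^2 * q \<le> 1" using q by (intro mult_le_one power_le_one) auto
  finally show ?thesis using assms by simp
qed (use assms in \<open>auto simp: cutoff'_def\<close>)

lemma cutoff''_bound:
  assumes "0 < r" "0 < k" "k \<le> 1" "0 \<le> y"
  shows "\<bar>cutoff'' k r y\<bar> * y^2 \<le> 12 * k"
proof (cases "y \<le> r")
  case False
  define q where "q = (r / y) powr k"
  have q: "0 < q" "q \<le> 1" using ratio_powr_bounds[of r y k] assms False by (auto simp: q_def)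
  have "\<bar>cutoff'' k r y\<bar> * y^2 = \<bar>6 * (1 - q) * (k * q)^2 - 3 * (1 - q)^2 * (k * (k + 1) * q)\<bar>"
    using False assms q by (simp add: cutoff''_def q_def[symmetric])
  also have "\<dots> \<le> \<bar>6 * ((1 - q) * (k * q)^2)\<bar> + \<bar>3 * ((1 - q)^2 * (k * (k + 1) * q))\<bar>"
    using abs_triangle_ineq4[of "6 * ((1 - q) * (k * q)^2)" "3 * ((1 - q)^2 * (k * (k + 1) * q))"]
    by (simp only: mult.assoc)
  also have "\<dots> = 6 * ((1 - q) * (k * q)^2) + 3 * ((1 - q)^2 * (k * (k + 1) * q))"
    using q assms by simp
  \<comment> \<open>Here \<open>k \<le> 1\<close> turns \<open>k^2\<close> into \<open>k\<close>.
    The other term uses \<open>k + 1 \<le> 2\<close>, and 12 = 6 + 3 * 2.\<close>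
  also have "(1 - q) * (k * q)^2 \<le> 1 * k"
  proof (rule mult_mono)
    have "(k * q)^2 = k * (k * q^2)" by (simp add: power2_eq_square)
    also have "\<dots> \<le> k * 1" using q assms by (intro mult_left_mono mult_le_one power_le_one) auto
    finally show "(k * q)^2 \<le> k" by simp
  qed (use q assms in auto)
  also have "(1 - q)^2 * (k * (k + 1) * q) \<le> 1 * (k * 2 * 1)"
    using q assms by (intro mult_mono power_le_one) auto
  finally show ?thesis by simp
qed (use assms in \<open>auto simp: cutoff''_def\<close>)

lemma gradient_coord_sum: "gradient N (\<lambda>x. \<Sum>i<N. x i) (\<lambda>i x. 1)"
proof -
  have "(\<lambda>t. \<Sum>i<N. x i + t * u i) = (\<lambda>t. (\<Sum>i<N. x i) + t * (\<Sum>i<N. u i))" for x u :: "nat \<Rightarrow> real"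
    by (simp add: sum.distrib sum_distrib_left)
  then show ?thesis
    unfolding gradient_def by (auto intro!: derivative_eq_intros)
qed

text \<open>All second partial derivatives of the squared sum equal 2, so this one term gives every
  entry of the Hessian the same slack \<open>2 * l\<close>.\<close>

definition blend :: "nat \<Rightarrow> real \<Rightarrow> real \<Rightarrow> real \<Rightarrow> ((nat \<Rightarrow> real) \<Rightarrow> real) \<Rightarrow> ((nat \<Rightarrow> real) \<Rightarrow> real)
    \<Rightarrow> ((nat \<Rightarrow> real) \<Rightarrow> real) \<Rightarrow> (nat \<Rightarrow> real) \<Rightarrow> real" where
  "blend N k r l \<rho> F G x = G x + cutoff k r (\<rho> x) * (F x - G x) + l * (\<Sum>i<N. x i)^2"

text \<open>
  The second derivatives of \<open>F\<close> and \<open>G\<close> enter only through a convex combination. Every other term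
  contains a derivative of the cutoff, and the factors \<open>F - G = O(\<rho>)\<close>, \<open>DF - DG = O(\<surd>\<rho>)\<close>,
  \<open>R = O(\<surd>\<rho>)\<close> turn it into \<open>O(k)\<close>, which the \<open>2 l\<close> from the quadratic term absorbs.
\<close>

lemma blend_hessian_nonneg:
  assumes F: "nonneg_C2 N F DF HF" and G: "nonneg_C2 N G DG HG"
    and R: "gradient N \<rho> R" and Q: "\<And>i. i < N \<Longrightarrow> gradient N (R i) (Q i)"
    and c: "0 \<le> c"
    and b0: "\<And>x. x \<in> unit_cube N \<Longrightarrow> 0 \<le> \<rho> x"
    and bR: "\<And>x i. x \<in> unit_cube N \<Longrightarrow> i < N \<Longrightarrow> \<bar>R i x\<bar> \<le> c * sqrt (\<rho> x)"
    and bQ: "\<And>x i j. x \<in> unit_cube N \<Longrightarrow> i < N \<Longrightarrow> j < N \<Longrightarrow> \<bar>Q i j x\<bar> \<le> c"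
    and bh: "\<And>x. x \<in> unit_cube N \<Longrightarrow> \<bar>F x - G x\<bar> \<le> c * \<rho> x"
    and bD: "\<And>x i. x \<in> unit_cube N \<Longrightarrow> i < N \<Longrightarrow> \<bar>DF i x - DG i x\<bar> \<le> c * sqrt (\<rho> x)"
    and r: "0 < r" and k: "0 < k" "k \<le> 1" and l: "12 * k * c^3 + 9 * k * c^2 \<le> 2 * l"
  shows "\<exists>D H. gradient N (blend N k r l \<rho> F G) D \<and> (\<forall>i<N. gradient N (D i) (H i)) \<and>
      (\<forall>x\<in>unit_cube N. \<forall>i<N. \<forall>j<N. 0 \<le> H i j x)"
proof -
  let ?c0 = "\<lambda>x. cutoff k r (\<rho> x)" and ?c1 = "\<lambda>x. cutoff' k r (\<rho> x)" and ?c2 = "\<lambda>x. cutoff'' k r (\<rho> x)"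
  let ?S = "\<lambda>x. \<Sum>i<N. x i"
  \<comment> \<open>Kept in the form that \<open>gradient_mult\<close> produces, whence the factors
    0 and 1.\<close>
  let ?D = "\<lambda>i x. DG i x + (?c1 x * R i x * (F x - G x) + ?c0 x * (DF i x - DG i x))
     + (0 * (?S x * ?S x) + l * (1 * ?S x + ?S x * 1))"
  let ?T = "\<lambda>i j x. ((?c2 x * R j x) * R i x + ?c1 x * Q i j x) * (F x - G x)
       + (?c1 x * R i x) * (DF j x - DG j x) + (?c1 x * R j x) * (DF i x - DG i x)"
  let ?H = "\<lambda>i j x. (1 - ?c0 x) * HG i j x + ?c0 x * HF i j x + ?T i j x + 2 * l"
  have gF: "gradient N F DF" "\<And>i. i < N \<Longrightarrow> gradient N (DF i) (HF i)"
    using F by (auto simp: nonneg_C2_def)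
  have gG: "gradient N G DG" "\<And>i. i < N \<Longrightarrow> gradient N (DG i) (HG i)"
    using G by (auto simp: nonneg_C2_def)
  have g0: "gradient N ?c0 (\<lambda>i x. ?c1 x * R i x)"
    by (rule gradient_compose[OF R DERIV_cutoff[OF r]])
  have g1: "gradient N ?c1 (\<lambda>i x. ?c2 x * R i x)"
    by (rule gradient_compose[OF R DERIV_cutoff'[OF r]])
  have gS: "gradient N (\<lambda>x. l * (?S x * ?S x)) (\<lambda>i x. 0 * (?S x * ?S x) + l * (1 * ?S x + ?S x * 1))"
    by (intro gradient_mult gradient_const gradient_coord_sum)
  have "gradient N (\<lambda>x. G x + ?c0 x * (F x - G x) + l * (?S x * ?S x)) ?D"
    by (intro gradient_add gradient_diff gradient_mult gS gG gF g0)
  moreover have "(\<lambda>x. G x + ?c0 x * (F x - G x) + l * (?S x * ?S x)) = blend N k r l \<rho> F G"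
    by (simp add: blend_def power2_eq_square fun_eq_iff)
  ultimately have "gradient N (blend N k r l \<rho> F G) ?D" by simp
  note gD = this
  have gH: "gradient N (?D i) (?H i)" if i: "i < N" for i
  proof -
    let ?s = "\<lambda>x. l * (?S x + ?S x)"
    have "gradient N (\<lambda>x. DG i x + (?c1 x * R i x * (F x - G x) + ?c0 x * (DF i x - DG i x)) + ?s x)
      (\<lambda>j x. HG i j x + ((((?c2 x * R j x) * R i x + ?c1 x * Q i j x) * (F x - G x) + (?c1 x * R i x) * (DF j x - DG j x))
         + ((?c1 x * R j x) * (DF i x - DG i x) + ?c0 x * (HF i j x - HG i j x))) + (0 * (?S x + ?S x) + l * (1 + 1)))"
      by (intro gradient_add gradient_diff gradient_mult gradient_const gradient_coord_sum
        gG gF g0 g1 Q i)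
    then show ?thesis by (simp add: algebra_simps)
  qed
  have "0 \<le> ?H i j x" if x: "x \<in> unit_cube N" and i: "i < N" and j: "j < N" for x i j
  proof -
    define y where "y = \<rho> x"
    define s where "s = sqrt y"
    have y: "0 \<le> y" using b0[OF x] by (simp add: y_def)
    have s: "0 \<le> s" "s * s = y" using y by (auto simp: s_def)
    have "0 \<le> HG i j x" "0 \<le> HF i j x" using F G x i j by (auto simp: nonneg_C2_def)
    then have "0 \<le> (1 - ?c0 x) * HG i j x + ?c0 x * HF i j x"
      using cutoff_bounds[OF r k(1)] by auto
    \<comment> \<open>The term with the second derivative of the cutoff costs
      \<open>12 * k * c^3\<close>, the three with its first derivative \<open>3 * k * c^2\<close>
      each; together they form the left side of assumption \<open>l\<close>.\<close>
    moreover have "\<bar>?T i j x\<bar> \<le> 2 * l"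
    proof -
      have h: "\<bar>F x - G x\<bar> \<le> c * y" using bh[OF x] by (simp add: y_def)
      have Ri: "\<bar>R i x\<bar> \<le> c * s" and Rj: "\<bar>R j x\<bar> \<le> c * s" using bR[OF x] i j by (auto simp: y_def s_def)
      have Di: "\<bar>DF i x - DG i x\<bar> \<le> c * s" and Dj: "\<bar>DF j x - DG j x\<bar> \<le> c * s"
        using bD[OF x] i j by (auto simp: y_def s_def)
      have q: "\<bar>Q i j x\<bar> \<le> c" using bQ[OF x i j] .
      have cs: "0 \<le> c * s" using c s by simp
      have c1: "\<bar>?c1 x\<bar> * y \<le> 3 * k" unfolding y_def by (rule cutoff'_bound[OF r k(1)]) (use b0[OF x] in auto)
      have c2: "\<bar>?c2 x\<bar> * y^2 \<le> 12 * k" unfolding y_def by (rule cutoff''_bound[OF r k]) (use b0[OF x] in auto)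
      have "\<bar>?c2 x * R j x * R i x * (F x - G x)\<bar> = \<bar>?c2 x\<bar> * (\<bar>R j x\<bar> * \<bar>R i x\<bar> * \<bar>F x - G x\<bar>)"
        by (simp add: abs_mult)
      also have "\<dots> \<le> \<bar>?c2 x\<bar> * ((c * s) * (c * s) * (c * y))"
        using Ri Rj h cs by (intro mult_left_mono mult_mono) auto
      also have "\<dots> = (\<bar>?c2 x\<bar> * y^2) * c^3"
        by (simp add: s(2)[symmetric] power2_eq_square power3_eq_cube)
      also have "\<dots> \<le> (12 * k) * c^3" using c2 c by (intro mult_right_mono) auto
      finally have t1: "\<bar>?c2 x * R j x * R i x * (F x - G x)\<bar> \<le> 12 * k * c^3" .
      have "\<bar>?c1 x * Q i j x * (F x - G x)\<bar> = \<bar>?c1 x\<bar> * (\<bar>Q i j x\<bar> * \<bar>F x - G x\<bar>)"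
        by (simp add: abs_mult)
      also have "\<dots> \<le> \<bar>?c1 x\<bar> * (c * (c * y))"
        using q h c by (intro mult_left_mono mult_mono) auto
      also have "\<dots> = (\<bar>?c1 x\<bar> * y) * c^2" by (simp add: power2_eq_square)
      also have "\<dots> \<le> (3 * k) * c^2" using c1 c by (intro mult_right_mono) auto
      finally have t2: "\<bar>?c1 x * Q i j x * (F x - G x)\<bar> \<le> 3 * k * c^2" .
      have t: "\<bar>?c1 x * a * b\<bar> \<le> 3 * k * c^2" if "\<bar>a\<bar> \<le> c * s" "\<bar>b\<bar> \<le> c * s" for a b
      proof -
        have "\<bar>?c1 x * a * b\<bar> = \<bar>?c1 x\<bar> * (\<bar>a\<bar> * \<bar>b\<bar>)" by (simp add: abs_mult)
        also have "\<dots> \<le> \<bar>?c1 x\<bar> * ((c * s) * (c * s))"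
          using that cs by (intro mult_left_mono mult_mono) auto
        also have "\<dots> = (\<bar>?c1 x\<bar> * y) * c^2" by (simp add: s(2)[symmetric] power2_eq_square)
        also have "\<dots> \<le> (3 * k) * c^2" using c1 c by (intro mult_right_mono) auto
        finally show ?thesis .
      qed
      have "?T i j x = ?c2 x * R j x * R i x * (F x - G x) + ?c1 x * Q i j x * (F x - G x)
         + ?c1 x * R i x * (DF j x - DG j x) + ?c1 x * R j x * (DF i x - DG i x)"
        by (simp add: algebra_simps)
      then show ?thesis using t1 t2 t[OF Ri Dj] t[OF Rj Di] l by linarith
    qed
    ultimately show ?thesis by linarith
  qed
  then show ?thesis by (intro exI[of _ ?D] exI[of _ ?H] conjI ballI allI impI gD gH)
qed

subsection \<open>The hidden polynomial and its symmetrization\<close>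

text \<open>
  Coordinates below \<open>K\<close> are the roles \<open>a\<^sub>i\<close>, those from \<open>K\<close> to \<open>2K - 1\<close> the roles \<open>b\<^sub>i\<close>, and \<open>2K\<close>,
  \<open>2K + 1\<close> are \<open>a\<close> and \<open>b\<close>. The cut function is \<open>x a + x b\<close> minus the polynomial below.
\<close>

definition block_avg :: "nat \<Rightarrow> (nat \<Rightarrow> real) \<Rightarrow> nat \<Rightarrow> real" where
  "block_avg K x i = (if i < 2 * K then (\<Sum>j<2 * K. x j) / (2 * real K) else (x (2 * K) + x (Suc (2 * K))) / 2)"

text \<open>\<open>block_avg K x\<close> is the orthogonal projection of \<open>x\<close> onto the
  points fixed by the symmetry, so this is the squared distance to them.\<close>

definition dispersion :: "nat \<Rightarrow> (nat \<Rightarrow> real) \<Rightarrow> real" where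
  "dispersion K x = (\<Sum>i<2 * K + 2. (x i - block_avg K x i)^2)"

text \<open>A hyperedge is cut when its head is absent and some tail is present, which gives
  \<open>x a\<close> times 1 minus the product over the tails; the edge gives
  \<open>x a + x b - 2 * x a * x b\<close>. The linear parts add up to \<open>x a + x b\<close>
  since 7/20 + 13/20 = 1, and 13/10 is twice 13/20.\<close>

definition asym_poly :: "nat \<Rightarrow> (nat \<Rightarrow> real) \<Rightarrow> real" where
  "asym_poly K x = 7/20 * ((\<Prod>j<K. x j) * x (2 * K) + (\<Prod>j\<in>{K..<2 * K}. x j) * x (Suc (2 * K)))
     + 13/10 * (x (2 * K) * x (Suc (2 * K)))"

text \<open>This is \<open>asym_poly K\<close> evaluated at \<open>block_avg K x\<close>.\<close>

definition sym_poly :: "nat \<Rightarrow> (nat \<Rightarrow> real) \<Rightarrow> real" where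
  "sym_poly K x = 7/20 * (((\<Sum>j<2 * K. x j) / (2 * real K))^K * (x (2 * K) + x (Suc (2 * K))))
     + 13/40 * (x (2 * K) + x (Suc (2 * K)))^2"

lemma sum_two_blocks: "(\<Sum>i<2 * K + 2. f i) = (\<Sum>i<2 * K. f i) + f (2 * K) + (f (Suc (2 * K)) :: real)"
  by simp

lemma monotone_poly_asym: "monotone_poly (2 * K + 2) (asym_poly K)"
  unfolding asym_poly_def[abs_def]
  by (intro monotone_poly_add monotone_poly_mult monotone_poly_const monotone_poly_prod monotone_poly_coord) auto

lemma monotone_poly_sym: "monotone_poly (2 * K + 2) (sym_poly K)"
  unfolding sym_poly_def[abs_def] divide_inverse
  by (intro monotone_poly_add monotone_poly_mult monotone_poly_const monotone_poly_sum monotone_poly_power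
    monotone_poly_coord) auto

lemma block_avg_line: "block_avg K (\<lambda>i. x i + t * u i) i = block_avg K x i + t * block_avg K u i"
  by (simp add: block_avg_def sum.distrib sum_distrib_left[symmetric] add_divide_distrib algebra_simps)

text \<open>The residual of the projection is orthogonal to the fixed space. Hence the variation of
  the average drops out of the gradient of \<open>dispersion\<close>.\<close>

lemma block_avg_orthogonal:
  assumes "0 < K"
  shows "(\<Sum>i<2 * K + 2. (x i - block_avg K x i) * block_avg K u i) = 0"
proof -
  have "(\<Sum>i<2 * K. (x i - block_avg K x i) * block_avg K u i)
      = (\<Sum>i<2 * K. (x i - (\<Sum>j<2 * K. x j) / (2 * real K)) * ((\<Sum>j<2 * K. u j) / (2 * real K)))"
    by (intro sum.cong) (auto simp: block_avg_def)
  also have "\<dots> = 0"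
    using assms by (simp only: sum_distrib_right[symmetric] sum_subtractf) simp
  finally show ?thesis
    unfolding sum_two_blocks by (simp add: block_avg_def field_simps)
qed

lemma gradient_dispersion:
  assumes "0 < K"
  shows "gradient (2 * K + 2) (dispersion K) (\<lambda>i x. 2 * (x i - block_avg K x i))"
  unfolding gradient_def
proof (intro allI)
  fix x u
  let ?d = "\<lambda>i. x i - block_avg K x i" and ?e = "\<lambda>i. u i - block_avg K u i"
  have "((\<lambda>t. \<Sum>i<2 * K + 2. (?d i + t * ?e i)^2) has_real_derivative (\<Sum>i<2 * K + 2. 2 * ?e i * ?d i)) (at 0)"
    by (intro DERIV_sum) (auto intro!: derivative_eq_intros)
  moreover have "(\<Sum>i<2 * K + 2. 2 * ?e i * ?d i) = (\<Sum>i<2 * K + 2. u i * (2 * ?d i))"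
  proof -
    have "(\<Sum>i<2 * K + 2. 2 * ?e i * ?d i) = (\<Sum>i<2 * K + 2. u i * (2 * ?d i) - 2 * (?d i * block_avg K u i))"
      by (intro sum.cong) (auto simp: algebra_simps)
    also have "\<dots> = (\<Sum>i<2 * K + 2. u i * (2 * ?d i)) - 2 * (\<Sum>i<2 * K + 2. ?d i * block_avg K u i)"
      by (simp only: sum_subtractf sum_distrib_left)
    finally show ?thesis by (simp only: block_avg_orthogonal[OF assms])
  qed
  moreover have "dispersion K (\<lambda>i. x i + t * u i) = (\<Sum>i<2 * K + 2. (?d i + t * ?e i)^2)" for t
    unfolding dispersion_def block_avg_line by (intro sum.cong) (auto simp: algebra_simps)
  ultimately show "((\<lambda>t. dispersion K (\<lambda>i. x i + t * u i)) has_real_derivative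
      (\<Sum>i<2 * K + 2. u i * (2 * ?d i))) (at 0)" by simp
qed

text \<open>The matrix of the projection \<open>block_avg K\<close>.\<close>

definition avg_coeff :: "nat \<Rightarrow> nat \<Rightarrow> nat \<Rightarrow> real" where
  "avg_coeff K i j = (if i < 2 * K \<and> j < 2 * K then 1 / (2 * real K) else if i < 2 * K \<or> j < 2 * K then 0 else 1/2)"

lemma gradient_block_avg:
  "gradient (2 * K + 2) (\<lambda>x. block_avg K x i) (\<lambda>j x. avg_coeff K i j)"
proof -
  have "(\<Sum>j<2 * K + 2. u j * avg_coeff K i j) = block_avg K u i" for u
    unfolding sum_two_blocks by (auto simp: avg_coeff_def block_avg_def sum_divide_distrib add_divide_distrib)
  then show ?thesis
    unfolding gradient_def block_avg_line by (auto intro!: derivative_eq_intros)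
qed

lemma gradient_deviation:
  assumes "i < 2 * K + 2"
  shows "gradient (2 * K + 2) (\<lambda>x. 2 * (x i - block_avg K x i))
      (\<lambda>j x. 0 * (x i - block_avg K x i) + 2 * ((if j = i then 1 else 0) - avg_coeff K i j))"
  by (intro gradient_mult gradient_diff gradient_const gradient_coord gradient_block_avg assms)

lemma deviation_le_sqrt_dispersion:
  assumes "i < 2 * K + 2"
  shows "\<bar>x i - block_avg K x i\<bar> \<le> sqrt (dispersion K x)"
proof -
  have "(x i - block_avg K x i)^2 \<le> dispersion K x"
    unfolding dispersion_def using assms
    by (intro member_le_sum[of i _ "\<lambda>i. (x i - block_avg K x i)^2"]) auto
  then show ?thesis using real_le_rsqrt by (metis abs_le_square_iff real_sqrt_abs real_sqrt_le_iff)
qed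

lemma block_avg_unit_cube:
  assumes "0 < K" "x \<in> unit_cube (2 * K + 2)"
  shows "block_avg K x \<in> unit_cube (2 * K + 2)"
proof -
  have x: "0 \<le> x i" "x i \<le> 1" if "i < 2 * K + 2" for i using assms that by (auto simp: unit_cube_def)
  have "0 \<le> (\<Sum>j<2 * K. x j)" using x by (intro sum_nonneg) auto
  moreover have "(\<Sum>j<2 * K. x j) \<le> (\<Sum>j<2 * K. 1)" using x by (intro sum_mono) auto
  moreover have "0 \<le> x (2 * K) + x (Suc (2 * K))" "x (2 * K) + x (Suc (2 * K)) \<le> 2"
    using x[of "2 * K"] x[of "Suc (2 * K)"] by auto
  ultimately show ?thesis using assms by (auto simp: unit_cube_def block_avg_def)
qed

text \<open>For reading off partial derivatives at diagonal points: at most one factor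
  moves.\<close>

lemma prod_bump:
  fixes y :: "nat \<Rightarrow> real"
  assumes "finite A" "\<And>j. j \<in> A \<Longrightarrow> y j = z"
  shows "(\<Prod>j\<in>A. y j + (if j = i then t else 0)) = (if i \<in> A then (z + t) * z ^ (card A - 1) else z ^ card A)"
proof (cases "i \<in> A")
  case True
  have "(\<Prod>j\<in>A - {i}. y j + (if j = i then t else 0)) = (\<Prod>j\<in>A - {i}. z)"
    using assms by (intro prod.cong) auto
  then show ?thesis using True assms by (simp add: prod.remove[of A i])
next
  case False
  have "(\<Prod>j\<in>A. y j + (if j = i then t else 0)) = (\<Prod>j\<in>A. z)"
    using assms False by (intro prod.cong) auto
  then show ?thesis using False by simp
qed

lemma asym_eq_sym_on_diagonal:
  assumes K: "0 < K" and y: "\<And>j. j < 2 * K \<Longrightarrow> y j = z" "y (2 * K) = w" "y (Suc (2 * K)) = w"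
  shows "asym_poly K y = sym_poly K y"
proof -
  have "(\<Prod>j<K. y j) = (\<Prod>j<K. z)" "(\<Prod>j\<in>{K..<2*K}. y j) = (\<Prod>j\<in>{K..<2*K}. z)"
    using y(1) by (intro prod.cong; force)+
  moreover have "(\<Sum>j<2*K. y j) = 2 * real K * z" using y(1) by simp
  ultimately show ?thesis
    using K y by (simp add: asym_poly_def sym_poly_def algebra_simps power2_eq_square)
qed

text \<open>At a point fixed by the symmetry, the gradient of \<open>asym_poly\<close> is constant
  on each block and so equals that of the symmetrization. Both are computed coordinate by
  coordinate; as \<open>DF\<close> and \<open>DG\<close> are given only through
  \<open>gradient\<close>, uniqueness of derivatives identifies them.\<close>

lemma gradients_agree_on_diagonal:
  assumes K: "0 < K" and y: "\<And>j. j < 2 * K \<Longrightarrow> y j = z" "y (2 * K) = w" "y (Suc (2 * K)) = w"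
    and F: "gradient (2 * K + 2) (asym_poly K) DF" and G: "gradient (2 * K + 2) (sym_poly K) DG"
    and i: "i < 2 * K + 2"
  shows "DF i y = DG i y"
proof -
  let ?y = "\<lambda>t j. y j + (if j = i then t else 0)"
  have pA: "(\<Prod>j<K. ?y t j) = (if i < K then (z + t) * z ^ (K - 1) else z ^ K)" for t
    using prod_bump[of "{..<K}" y z i t] y(1) by simp
  have pB: "(\<Prod>j\<in>{K..<2*K}. ?y t j) = (if K \<le> i \<and> i < 2 * K then (z + t) * z ^ (K - 1) else z ^ K)" for t
    using prod_bump[of "{K..<2*K}" y z i t] y(1) by simp
  have s: "(\<Sum>j<2*K. ?y t j) = 2 * real K * z + (if i < 2 * K then t else 0)" for t
    using y(1) by (simp add: sum.distrib)
  have dF: "((\<lambda>t. asym_poly K (?y t)) has_real_derivative DF i y) (at 0)"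
    by (rule gradient_partial[OF F i])
  have dG: "((\<lambda>t. sym_poly K (?y t)) has_real_derivative DG i y) (at 0)"
    by (rule gradient_partial[OF G i])
  show ?thesis
  proof (cases "i < 2 * K")
    case True
    have "asym_poly K (?y t) = 7/20 * (((z + t) * z ^ (K - 1) + z ^ K) * w) + 13/10 * (w * w)" for t
      unfolding asym_poly_def pA pB using True y by (auto simp: algebra_simps)
    then have "((\<lambda>t. asym_poly K (?y t)) has_real_derivative 7/20 * (z ^ (K - 1) * w)) (at 0)"
      by (auto intro!: derivative_eq_intros)
    then have 1: "DF i y = 7/20 * (z ^ (K - 1) * w)" using dF DERIV_unique by blast
    have "sym_poly K (?y t) = 7/20 * ((z + t / (2 * real K))^K * (w + w)) + 13/40 * (w + w)^2" for t
      unfolding sym_poly_def s using True y K by (auto simp: field_simps)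
    then have "((\<lambda>t. sym_poly K (?y t)) has_real_derivative
        7/20 * (real K * z^(K - 1) * (1 / (2 * real K)) * (w + w))) (at 0)"
      by (auto intro!: derivative_eq_intros)
    then have "DG i y = 7/20 * (real K * z^(K - 1) * (1 / (2 * real K)) * (w + w))"
      using dG DERIV_unique by blast
    then show ?thesis using 1 K by (simp add: field_simps)
  next
    case False
    have "asym_poly K (?y t) = 7/20 * (z ^ K * (w + w + t)) + 13/10 * (w * (w + t))" for t
      unfolding asym_poly_def pA pB using False y i by (auto simp: algebra_simps)
    then have "((\<lambda>t. asym_poly K (?y t)) has_real_derivative 7/20 * z ^ K + 13/10 * w) (at 0)"
      by (auto intro!: derivative_eq_intros)
    then have 1: "DF i y = 7/20 * z ^ K + 13/10 * w" using dF DERIV_unique by blast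
    have ww: "?y t (2*K) + ?y t (Suc (2*K)) = w + w + t" for t
      using False i y by auto
    have "sym_poly K (?y t) = 7/20 * (z^K * (w + w + t)) + 13/40 * (w + w + t)^2" for t
      unfolding sym_poly_def s ww using False K by simp
    then have "((\<lambda>t. sym_poly K (?y t)) has_real_derivative 7/20 * z ^ K + 13/40 * (2 * (w + w))) (at 0)"
      by (auto intro!: derivative_eq_intros)
    then have "DG i y = 7/20 * z ^ K + 13/40 * (2 * (w + w))" using dG DERIV_unique by blast
    then show ?thesis using 1 by simp
  qed
qed

text \<open>The order of quantifiers is essential: the cutoff estimates are uniform in
  \<open>r\<close>, so \<open>k\<close> is fixed first and \<open>r\<close> can later be chosen tiny
  depending on \<open>k\<close>.\<close>

lemma blend_supermodular_hessian:
  assumes K: "0 < K" and l: "0 < l"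
  shows "\<exists>k. 0 < k \<and> k \<le> 1 \<and> (\<forall>r>0. \<exists>D H.
     gradient (2 * K + 2) (blend (2 * K + 2) k r l (dispersion K) (asym_poly K) (sym_poly K)) D \<and>
     (\<forall>i<2 * K + 2. gradient (2 * K + 2) (D i) (H i)) \<and>
     (\<forall>x\<in>unit_cube (2 * K + 2). \<forall>i<2 * K + 2. \<forall>j<2 * K + 2. 0 \<le> H i j x))"
proof -
  let ?N = "2 * K + 2"
  obtain DF HF where F: "nonneg_C2 ?N (asym_poly K) DF HF"
    using monotone_poly_asym unfolding monotone_poly_def by blast
  obtain DG HG where G: "nonneg_C2 ?N (sym_poly K) DG HG"
    using monotone_poly_sym unfolding monotone_poly_def by blast
  obtain A where A: "\<forall>x\<in>unit_cube ?N. 0 \<le> asym_poly K x \<and> asym_poly K x \<le> A \<and>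
       (\<forall>i<?N. 0 \<le> DF i x \<and> DF i x \<le> A \<and> (\<forall>j<?N. 0 \<le> HF i j x \<and> HF i j x \<le> A))"
    using F unfolding nonneg_C2_def by blast
  obtain B where B: "\<forall>x\<in>unit_cube ?N. 0 \<le> sym_poly K x \<and> sym_poly K x \<le> B \<and>
       (\<forall>i<?N. 0 \<le> DG i x \<and> DG i x \<le> B \<and> (\<forall>j<?N. 0 \<le> HG i j x \<and> HG i j x \<le> B))"
    using G unfolding nonneg_C2_def by blast
  define C where "C = \<bar>A\<bar> + \<bar>B\<bar>"
  \<comment> \<open>One constant for all bounds: 2 serves the derivatives of the dispersion, the
    other summands are the Taylor constants for the gap between the polynomials and for its
    gradient.\<close>
  define c where "c = 2 + real ?N * real ?N * C + real ?N * C"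
  have C0: "0 \<le> C" by (simp add: C_def)
  have c2: "2 \<le> c" and cN: "real ?N * real ?N * C \<le> c" and cN': "real ?N * C \<le> c"
    using C0 by (auto simp: c_def)
  define k where "k = min 1 (2 * l / (12 * c^3 + 9 * c^2))"
  have pos: "0 < 12 * c^3 + 9 * c^2" using c2 by (intro add_pos_pos) auto
  have k: "0 < k" "k \<le> 1" using l pos by (auto simp: k_def)
  have "k \<le> 2 * l / (12 * c^3 + 9 * c^2)" by (simp add: k_def)
  then have "k * (12 * c^3 + 9 * c^2) \<le> 2 * l" using pos by (simp only: pos_le_divide_eq)
  then have kl: "12 * k * c^3 + 9 * k * c^2 \<le> 2 * l" by (simp add: algebra_simps)
  have gh: "gradient ?N (\<lambda>x. asym_poly K x - sym_poly K x) (\<lambda>i x. DF i x - DG i x)"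
    using F G by (intro gradient_diff) (auto simp: nonneg_C2_def)
  have gd: "gradient ?N (\<lambda>x. DF i x - DG i x) (\<lambda>j x. HF i j x - HG i j x)" if "i < ?N" for i
    using F G that by (intro gradient_diff) (auto simp: nonneg_C2_def)
  have bC: "\<bar>HF i j x - HG i j x\<bar> \<le> C" if "x \<in> unit_cube ?N" "i < ?N" "j < ?N" for x i j
  proof -
    have "0 \<le> HF i j x" "HF i j x \<le> A" "0 \<le> HG i j x" "HG i j x \<le> B" using A B that by auto
    then show ?thesis by (auto simp: C_def)
  qed
  have bnd: "\<bar>asym_poly K x - sym_poly K x\<bar> \<le> c * dispersion K x"
      "\<And>i. i < ?N \<Longrightarrow> \<bar>DF i x - DG i x\<bar> \<le> c * sqrt (dispersion K x)"
    if x: "x \<in> unit_cube ?N" for x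
  proof -
    let ?y = "block_avg K x"
    define z w where "z = (\<Sum>j<2 * K. x j) / (2 * real K)" and "w = (x (2 * K) + x (Suc (2 * K))) / 2"
    have y: "\<And>j. j < 2 * K \<Longrightarrow> ?y j = z" "?y (2 * K) = w" "?y (Suc (2 * K)) = w"
      by (auto simp: block_avg_def z_def w_def)
    have rho: "0 \<le> dispersion K x" unfolding dispersion_def by (intro sum_nonneg) auto
    have h0: "asym_poly K ?y - sym_poly K ?y = 0" using asym_eq_sym_on_diagonal[OF K y] by simp
    have d0: "DF i ?y - DG i ?y = 0" if "i < ?N" for i
      using gradients_agree_on_diagonal[OF K y _ _ that] F G by (simp add: nonneg_C2_def)
    have dev: "\<bar>x i - ?y i\<bar> \<le> sqrt (dispersion K x)" if "i < ?N" for i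
      by (rule deviation_le_sqrt_dispersion[OF that])
    \<comment> \<open>Expansion at the projection \<open>?y\<close> of \<open>x\<close>, where the
      polynomials agree to first order; each coordinate moves by at most the root of the
      dispersion.\<close>
    note so = second_order_bound[OF gh gd bC x block_avg_unit_cube[OF K x] h0 d0 dev]
    have "\<bar>asym_poly K x - sym_poly K x\<bar> \<le> real ?N * real ?N * C * (sqrt (dispersion K x))^2"
      by (rule so(1)) (use rho in auto)
    also have "\<dots> \<le> c * dispersion K x" using rho cN by (simp add: mult_right_mono)
    finally show "\<bar>asym_poly K x - sym_poly K x\<bar> \<le> c * dispersion K x" .
    fix i assume i: "i < ?N"
    have "\<bar>DF i x - DG i x\<bar> \<le> real ?N * C * sqrt (dispersion K x)"
      by (rule so(2)) (use rho i in auto)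
    also have "\<dots> \<le> c * sqrt (dispersion K x)" using rho cN' by (intro mult_right_mono) auto
    finally show "\<bar>DF i x - DG i x\<bar> \<le> c * sqrt (dispersion K x)" .
  qed
  have "\<exists>D H. gradient ?N (blend ?N k r l (dispersion K) (asym_poly K) (sym_poly K)) D \<and>
     (\<forall>i<?N. gradient ?N (D i) (H i)) \<and> (\<forall>x\<in>unit_cube ?N. \<forall>i<?N. \<forall>j<?N. 0 \<le> H i j x)" if "0 < r" for r
  proof (rule blend_hessian_nonneg[OF F G gradient_dispersion[OF K] gradient_deviation, where c = c])
    show "0 \<le> dispersion K x" for x unfolding dispersion_def by (intro sum_nonneg) auto
    then have sq: "0 \<le> sqrt (dispersion K x)" for x by simp
    show "\<bar>2 * (x i - block_avg K x i)\<bar> \<le> c * sqrt (dispersion K x)" if "i < ?N" for x i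
    proof -
      have "\<bar>2 * (x i - block_avg K x i)\<bar> \<le> 2 * sqrt (dispersion K x)"
        using deviation_le_sqrt_dispersion[OF that, of x] by (simp add: abs_mult)
      also have "\<dots> \<le> c * sqrt (dispersion K x)" using c2 sq[of x] by (intro mult_right_mono)
      finally show ?thesis .
    qed
    show "\<bar>0 * (x i - block_avg K x i) + 2 * ((if j = i then 1 else 0) - avg_coeff K i j)\<bar> \<le> c" for x i j
    proof -
      have "0 \<le> avg_coeff K i j" "avg_coeff K i j \<le> 1" using K by (auto simp: avg_coeff_def)
      then have "\<bar>(if j = i then 1 else 0) - avg_coeff K i j\<bar> \<le> 1" by auto
      then show ?thesis using c2 by (simp add: abs_mult)
    qed
  qed (use bnd kl k c2 that in auto)
  then show ?thesis using k by blast
qed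

subsection \<open>Concentration over random shifts\<close>

lemma sum_rotate:
  fixes \<phi> :: "nat \<Rightarrow> real"
  assumes "0 < M"
  shows "(\<Sum>i<M. \<phi> ((i + v) mod M)) = (\<Sum>i<M. \<phi> i)"
proof (induction v)
  case (Suc v)
  obtain L where L: "M = Suc L" using assms by (cases M) auto
  let ?p = "\<lambda>i. \<phi> ((i + v) mod M)"
  have "(\<Sum>i<M. \<phi> ((i + Suc v) mod M)) = (\<Sum>i<M. ?p (Suc i mod M))"
    by (simp add: mod_simps)
  also have "\<dots> = (\<Sum>i<L. ?p (Suc i)) + ?p 0"
    unfolding L by (simp add: sum.lessThan_Suc)
  also have "\<dots> = (\<Sum>i<M. ?p i)" unfolding L by (subst sum.lessThan_Suc_shift) (simp add: add.commute)
  finally show ?case using Suc by simp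
qed simp

text \<open>Shifts run over \<open>2 * K\<close> values, but the last two positions of a group see
  only their parity.\<close>

lemma sum_alternate:
  fixes \<phi> :: "nat \<Rightarrow> real"
  shows "(\<Sum>v<2 * K. \<phi> ((i + v) mod 2)) = real K * (\<phi> 0 + \<phi> 1)"
proof (induction K)
  case (Suc K)
  have "\<phi> ((i + 2 * K) mod 2) + \<phi> (Suc (i + 2 * K) mod 2) = \<phi> 0 + \<phi> 1"
    by (cases "even i") (auto simp: even_iff_mod_2_eq_zero odd_iff_mod_2_eq_one mod_Suc)
  then show ?case using Suc by (simp add: algebra_simps)
qed simp

text \<open>\<open>slot K v i\<close> is the position, within a group shifted by \<open>v\<close>, of the element of role \<open>i\<close>.\<close>

definition slot :: "nat \<Rightarrow> nat \<Rightarrow> nat \<Rightarrow> nat" where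
  "slot K v i = (if i < 2 * K then (i + v) mod (2 * K) else 2 * K + (i + v) mod 2)"

text \<open>Measuring absence rather than presence gives both hidden polynomials nonnegative
  coefficients, which \<open>monotone_poly\<close> exploits.\<close>

definition absent :: "nat \<Rightarrow> nat \<Rightarrow> (nat \<Rightarrow> nat) \<Rightarrow> nat set \<Rightarrow> nat \<Rightarrow> real" where
  "absent K m s S i = (\<Sum>g<m. of_bool (g * (2 * K + 2) + slot K (s g) i \<notin> S)) / real m"

lemma slot_less: "0 < K \<Longrightarrow> slot K v i < 2 * K + 2"
  unfolding slot_def using mod_less_divisor[of "2 * K" "i + v"] mod_less_divisor[of 2 "i + v"]
  by (auto simp del: mod_less_divisor)

lemma group_slot_eq:
  assumes "p < N" "q < (N::nat)" "g * N + p = h * N + q"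
  shows "g = h \<and> p = q"
proof -
  have "(g * N + p) div N = g" using assms(1) by simp
  moreover have "(h * N + q) div N = h" using assms(2) by simp
  ultimately have "g = h" using assms(3) by simp
  then show ?thesis using assms(3) by simp
qed

lemma absent_modular: "absent K m s (S \<union> T) i + absent K m s (S \<inter> T) i = absent K m s S i + absent K m s T i"
  unfolding absent_def add_divide_distrib[symmetric] sum.distrib[symmetric]
  by (intro arg_cong2[of _ _ _ _ "(/)"] sum.cong) auto

lemma absent_antimono: "S \<subseteq> T \<Longrightarrow> absent K m s T i \<le> absent K m s S i"
  unfolding absent_def by (intro divide_right_mono sum_mono) auto

lemma absent_bounds: "0 \<le> absent K m s S i" "absent K m s S i \<le> 1"
proof -
  have "(\<Sum>g<m. of_bool (g * (2 * K + 2) + slot K (s g) i \<notin> S)) \<le> (\<Sum>g<m. 1 :: real)"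
    by (intro sum_mono) auto
  then show "absent K m s S i \<le> 1" by (simp add: absent_def divide_le_eq)
qed (simp add: absent_def sum_nonneg)

lemma absent_unit_cube: "absent K m s S \<in> unit_cube N"
  by (simp add: unit_cube_def absent_bounds)

definition group_count :: "nat \<Rightarrow> nat set \<Rightarrow> nat \<Rightarrow> real" where
  "group_count K S g = (\<Sum>j<2 * K. of_bool (g * (2 * K + 2) + j \<notin> S))"

definition pair_count :: "nat \<Rightarrow> nat set \<Rightarrow> nat \<Rightarrow> real" where
  "pair_count K S g = of_bool (g * (2 * K + 2) + 2 * K \<notin> S) + of_bool (g * (2 * K + 2) + Suc (2 * K) \<notin> S)"

text \<open>A shift permutes the large block of each group, so the secret \<open>s\<close> drops out
  of the block sum. In \<open>sum_absent_small_block\<close> it at most swaps the pair.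
  \<open>sym_poly\<close> depends on nothing else.\<close>

lemma sum_absent_large_block:
  assumes "0 < K"
  shows "(\<Sum>i<2 * K. absent K m s S i) = (\<Sum>g<m. group_count K S g) / real m"
proof -
  have "(\<Sum>i<2 * K. \<Sum>g<m. of_bool (g * (2 * K + 2) + slot K (s g) i \<notin> S))
     = (\<Sum>g<m. \<Sum>i<2 * K. (of_bool (g * (2 * K + 2) + slot K (s g) i \<notin> S) :: real))"
    by (rule sum.swap)
  also have "\<dots> = (\<Sum>g<m. \<Sum>i<2 * K. of_bool (g * (2 * K + 2) + (i + s g) mod (2 * K) \<notin> S))"
    by (simp add: slot_def)
  also have "\<dots> = (\<Sum>g<m. group_count K S g)"
    using sum_rotate[of "2 * K" "\<lambda>j. of_bool (_ * (2 * K + 2) + j \<notin> S)"] assms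
    by (simp add: group_count_def)
  finally show ?thesis unfolding absent_def sum_divide_distrib[symmetric] by simp
qed

lemma sum_absent_small_block:
  "absent K m s S (2 * K) + absent K m s S (Suc (2 * K)) = (\<Sum>g<m. pair_count K S g) / real m"
proof -
  have "of_bool (g * (2 * K + 2) + slot K v (2 * K) \<notin> S) + of_bool (g * (2 * K + 2) + slot K v (Suc (2 * K)) \<notin> S)
     = pair_count K S g" for g v
    by (cases "even v") (auto simp: slot_def pair_count_def even_iff_mod_2_eq_zero odd_iff_mod_2_eq_one mod_Suc)
  then show ?thesis unfolding absent_def add_divide_distrib[symmetric] sum.distrib[symmetric] by simp
qed

section \<open>Chernoff bound for shift vectors\<close>

lemma exp_le_quadratic:
  fixes y :: real
  assumes "\<bar>y\<bar> \<le> 1"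
  shows "exp y \<le> 1 + y + y^2"
proof (cases "0 \<le> y")
  case True
  then show ?thesis using exp_bound[of y] assms by simp
next
  case False
  \<comment> \<open>For negative \<open>y\<close> the bound comes from the reciprocal of the
    quadratic Taylor lower bound for \<open>exp z\<close>.\<close>
  define z where "z = - y"
  have z: "0 \<le> z" using False by (simp add: z_def)
  have p: "0 < 1 + z + z^2 / 2" using z by (simp add: add_pos_nonneg)
  have "1 + z + z^2 / 2 \<le> exp z" using exp_lower_Taylor_quadratic[OF z] .
  then have "inverse (exp z) \<le> inverse (1 + z + z^2 / 2)" using p by (rule le_imp_inverse_le)
  also have "\<dots> \<le> 1 - z + z^2"
  proof -
    have "(1 - z + z^2) * (1 + z + z^2 / 2) = 1 + z^2 / 2 + z^3 / 2 + z^4 / 2"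
      by (simp add: power2_eq_square power3_eq_cube power4_eq_xxxx field_simps)
    also have "1 \<le> \<dots>" using z by simp
    finally show ?thesis using p by (simp add: inverse_eq_divide pos_divide_le_eq)
  qed
  finally show ?thesis by (simp add: z_def exp_minus)
qed

text \<open>Chernoff's method for independent uniform shifts, phrased by counting: the exponential
  moment over all shift vectors factors over the groups, and centring removes the linear term of
  each factor.\<close>

lemma hoeffding_count:
  fixes Y :: "nat \<Rightarrow> nat \<Rightarrow> real"
  assumes Y0: "\<And>g. g < m \<Longrightarrow> (\<Sum>v<M. Y g v) = 0"
    and Y1: "\<And>g v. g < m \<Longrightarrow> v < M \<Longrightarrow> \<bar>Y g v\<bar> \<le> 1"
    and t: "0 \<le> t" "t \<le> 2"
  shows "real (card {s \<in> {..<m} \<rightarrow>\<^sub>E {..<M}. t * real m \<le> (\<Sum>g<m. Y g (s g))})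
     \<le> real M ^ m * exp (- (t^2 / 4) * real m)"
proof -
  let ?\<Omega> = "{..<m} \<rightarrow>\<^sub>E {..<M}"
  let ?B = "{s \<in> ?\<Omega>. t * real m \<le> (\<Sum>g<m. Y g (s g))}"
  \<comment> \<open>This minimizes the exponent \<open>h^2 - h * t\<close>, with minimum
    \<open>- (t^2 / 4)\<close>; \<open>t \<le> 2\<close> gives the \<open>h \<le> 1\<close> needed
    for \<open>exp_le_quadratic\<close>.\<close>
  define h where "h = t / 2"
  have h: "0 \<le> h" "h \<le> 1" using t by (auto simp: h_def)
  have fin: "finite ?\<Omega>" by (intro finite_PiE) auto
  have "real (card ?B) * exp (h * (t * real m)) = (\<Sum>s\<in>?B. exp (h * (t * real m)))" by simp
  also have "\<dots> \<le> (\<Sum>s\<in>?B. exp (h * (\<Sum>g<m. Y g (s g))))"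
    using h by (intro sum_mono) (auto intro!: mult_left_mono)
  also have "\<dots> \<le> (\<Sum>s\<in>?\<Omega>. exp (h * (\<Sum>g<m. Y g (s g))))"
    using fin by (intro sum_mono2) auto
  also have "\<dots> = (\<Sum>s\<in>?\<Omega>. \<Prod>g<m. exp (h * Y g (s g)))"
    by (simp add: sum_distrib_left exp_sum)
  also have "\<dots> = (\<Prod>g<m. \<Sum>v<M. exp (h * Y g v))"
    by (subst prod_sum_PiE) auto
  also have "\<dots> \<le> (\<Prod>g<m. real M * exp (h^2))"
  proof (intro prod_mono conjI sum_nonneg)
    fix g assume g: "g \<in> {..<m}"
    have "(\<Sum>v<M. exp (h * Y g v)) \<le> (\<Sum>v<M. 1 + h * Y g v + h^2)"
    proof (rule sum_mono)
      fix v assume v: "v \<in> {..<M}"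
      have y: "\<bar>Y g v\<bar> \<le> 1" using Y1 g v by auto
      then have "\<bar>h * Y g v\<bar> \<le> 1" using h by (simp add: abs_mult mult_le_one)
      then have "exp (h * Y g v) \<le> 1 + h * Y g v + (h * Y g v)^2" by (rule exp_le_quadratic)
      also have "(h * Y g v)^2 \<le> h^2" using y by (simp add: power_mult_distrib mult_left_le abs_square_le_1)
      finally show "exp (h * Y g v) \<le> 1 + h * Y g v + h^2" by simp
    qed
    also have "\<dots> = real M * (1 + h^2)"
      using Y0 g by (simp add: sum.distrib sum_distrib_left[symmetric] algebra_simps)
    also have "\<dots> \<le> real M * exp (h^2)" by (intro mult_left_mono) (simp_all add: exp_ge_add_one_self)
    finally show "(\<Sum>v<M. exp (h * Y g v)) \<le> real M * exp (h^2)" .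
  qed simp
  also have "\<dots> = real M ^ m * exp (h^2 * real m)"
    by (simp add: power_mult_distrib exp_of_nat_mult[symmetric] mult.commute)
  finally have *: "real (card ?B) * exp (h * (t * real m)) \<le> real M ^ m * exp (h^2 * real m)" .
  have "real (card ?B) = real (card ?B) * exp (h * (t * real m)) * exp (- (h * (t * real m)))"
    by (simp add: mult.assoc exp_add[symmetric])
  also have "\<dots> \<le> real M ^ m * exp (h^2 * real m) * exp (- (h * (t * real m)))"
    using * by (intro mult_right_mono) auto
  also have "\<dots> = real M ^ m * exp (h^2 * real m - h * (t * real m))"
    by (simp add: exp_diff exp_minus field_simps)
  also have "h^2 * real m - h * (t * real m) = - (t^2 / 4) * real m"
    by (simp add: h_def power2_eq_square field_simps)
  finally show ?thesis .
qed

text \<open>The block average does not depend on \<open>s\<close> and splits into one constant per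
  group, so the deviation is a sum of independent centred terms.\<close>

lemma deviation_as_sum:
  assumes K: "0 < K" and m: "0 < m" and i: "i < 2 * K + 2"
  obtains Y :: "nat \<Rightarrow> nat \<Rightarrow> real"
  where "\<And>s. (\<Sum>g<m. Y g (s g)) = real m * (absent K m s S i - block_avg K (absent K m s S) i)"
    and "\<And>g. (\<Sum>v<2 * K. Y g v) = 0" and "\<And>g v. \<bar>Y g v\<bar> \<le> 1"
proof
  \<comment> \<open>The mean, over all shifts of group \<open>g\<close>, of the indicator that its
    element of role \<open>i\<close> is absent.\<close>
  define c where "c g = (if i < 2 * K then group_count K S g / (2 * real K) else pair_count K S g / 2)" for g
  let ?b = "\<lambda>g v. of_bool (g * (2 * K + 2) + slot K v i \<notin> S) :: real"
  let ?Y = "\<lambda>g v. ?b g v - c g"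
  have sumc: "(\<Sum>g<m. c g) = real m * block_avg K (absent K m s S) i" for s
  proof (cases "i < 2 * K")
    case True
    then show ?thesis using m
      by (simp add: c_def block_avg_def sum_absent_large_block[OF K] sum_divide_distrib[symmetric])
  next
    case False
    then show ?thesis using m
      by (simp add: c_def block_avg_def sum_absent_small_block sum_divide_distrib[symmetric])
  qed
  show "(\<Sum>g<m. ?Y g (s g)) = real m * (absent K m s S i - block_avg K (absent K m s S) i)" for s
    unfolding sum_subtractf sumc[of s] using m by (simp add: absent_def right_diff_distrib)
  show "(\<Sum>v<2 * K. ?Y g v) = 0" for g
  proof (cases "i < 2 * K")
    case True
    have "(\<Sum>v<2 * K. ?b g v) = (\<Sum>v<2 * K. of_bool (g * (2 * K + 2) + (v + i) mod (2 * K) \<notin> S))"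
      using True by (simp add: slot_def add.commute)
    also have "\<dots> = group_count K S g"
      using sum_rotate[of "2 * K" "\<lambda>j. of_bool (g * (2 * K + 2) + j \<notin> S)" i] K by (simp add: group_count_def)
    finally show ?thesis unfolding sum_subtractf using True K by (simp add: c_def)
  next
    case False
    have "(\<Sum>v<2 * K. ?b g v) = (\<Sum>v<2 * K. of_bool (g * (2 * K + 2) + (2 * K + (i + v) mod 2) \<notin> S))"
      using False by (simp add: slot_def)
    also have "\<dots> = real K * pair_count K S g"
      using sum_alternate[of "\<lambda>j. of_bool (g * (2 * K + 2) + (2 * K + j) \<notin> S)" i K] by (simp add: pair_count_def)
    finally show ?thesis unfolding sum_subtractf using False K by (simp add: c_def)
  qed
  show "\<bar>?Y g v\<bar> \<le> 1" for g v
  proof -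
    have "0 \<le> group_count K S g" by (simp add: group_count_def sum_nonneg)
    moreover have "group_count K S g \<le> (\<Sum>j<2*K. 1)" unfolding group_count_def by (intro sum_mono) auto
    moreover have "0 \<le> pair_count K S g" "pair_count K S g \<le> 2" by (auto simp: pair_count_def)
    ultimately have "0 \<le> c g" "c g \<le> 1" using K by (auto simp: c_def)
    then show ?thesis by auto
  qed
qed

text \<open>Union bound over the \<open>2 * K + 2\<close> coordinates and the two signs of the
  deviation.\<close>

lemma dispersion_count:
  assumes K: "0 < K" and m: "0 < m" and r: "0 < r" "r \<le> 1"
  shows "real (card {s \<in> {..<m} \<rightarrow>\<^sub>E {..<2 * K}. r < dispersion K (absent K m s S)})
    \<le> 2 * real (2 * K + 2) * (real (2 * K) ^ m * exp (- (r / (4 * real (2 * K + 2))) * real m))"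
proof -
  let ?\<Omega> = "{..<m} \<rightarrow>\<^sub>E {..<2 * K}" and ?N = "2 * K + 2"
  \<comment> \<open>If every deviation stays below this \<open>t\<close>, the squares sum to at most
    \<open>r\<close>.\<close>
  define t where "t = sqrt (r / real ?N)"
  have t: "0 \<le> t" "t \<le> 2" "t^2 = r / real ?N"
  proof -
    have "r / real ?N \<le> 1" using r by (simp add: divide_le_eq)
    then have "t \<le> 1" by (simp add: t_def)
    then show "t \<le> 2" by simp
  qed (use r in \<open>auto simp: t_def\<close>)
  let ?dev = "\<lambda>i s. real m * (absent K m s S i - block_avg K (absent K m s S) i)"
  let ?bnd = "real (2 * K) ^ m * exp (- (t^2 / 4) * real m)"
  define P where "P i = {s \<in> ?\<Omega>. t * real m \<le> ?dev i s}" for i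
  define Q where "Q i = {s \<in> ?\<Omega>. t * real m \<le> - ?dev i s}" for i
  have fin: "finite ?\<Omega>" by (intro finite_PiE) auto
  have P: "real (card (P i)) \<le> ?bnd" and Q: "real (card (Q i)) \<le> ?bnd" if i: "i < ?N" for i
  proof -
    obtain Y where Y: "\<And>s. (\<Sum>g<m. Y g (s g)) = ?dev i s" "\<And>g. (\<Sum>v<2 * K. Y g v) = 0"
      "\<And>g v. \<bar>Y g v\<bar> \<le> 1" using deviation_as_sum[OF K m i] by metis
    show "real (card (P i)) \<le> ?bnd"
      using hoeffding_count[of m Y "2 * K" t] Y t by (simp add: P_def)
    show "real (card (Q i)) \<le> ?bnd"
      using hoeffding_count[of m "\<lambda>g v. - Y g v" "2 * K" t] Y t by (simp add: Q_def sum_negf)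
  qed
  have "{s \<in> ?\<Omega>. r < dispersion K (absent K m s S)} \<subseteq> (\<Union>i<?N. P i \<union> Q i)"
  proof
    fix s assume s: "s \<in> {s \<in> ?\<Omega>. r < dispersion K (absent K m s S)}"
    let ?d = "\<lambda>i. absent K m s S i - block_avg K (absent K m s S) i"
    have "\<exists>i<?N. t \<le> \<bar>?d i\<bar>"
    proof (rule ccontr)
      assume "\<not> ?thesis"
      then have "(?d i)^2 \<le> t^2" if "i < ?N" for i
        using that t(1) by (metis abs_le_square_iff abs_of_nonneg less_imp_le not_le)
      then have "dispersion K (absent K m s S) \<le> (\<Sum>i<?N. t^2)"
        unfolding dispersion_def by (intro sum_mono) auto
      also have "\<dots> = r" unfolding t(3) by simp
      finally show False using s by simp
    qed
    then obtain i where i: "i < ?N" "t \<le> \<bar>?d i\<bar>" by blast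
    have "t * real m \<le> \<bar>?d i\<bar> * real m" using i by (intro mult_right_mono) auto
    then have "s \<in> P i \<union> Q i"
      using s by (cases "0 \<le> ?d i") (auto simp: P_def Q_def abs_if algebra_simps split: if_splits)
    then show "s \<in> (\<Union>i<?N. P i \<union> Q i)" using i by blast
  qed
  moreover have "finite (\<Union>i<?N. P i \<union> Q i)" using fin by (auto simp: P_def Q_def)
  ultimately have "card {s \<in> ?\<Omega>. r < dispersion K (absent K m s S)} \<le> card (\<Union>i<?N. P i \<union> Q i)"
    by (intro card_mono)
  also have "\<dots> \<le> (\<Sum>i<?N. card (P i \<union> Q i))" by (rule card_UN_le) simp
  also have "\<dots> \<le> (\<Sum>i<?N. card (P i) + card (Q i))" by (intro sum_mono card_Un_le)
  finally have "real (card {s \<in> ?\<Omega>. r < dispersion K (absent K m s S)}) \<le> (\<Sum>i<?N. real (card (P i)) + real (card (Q i)))"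
    by (simp only: of_nat_add[symmetric] of_nat_sum[symmetric] of_nat_le_iff)
  also have "\<dots> \<le> (\<Sum>i<?N. ?bnd + ?bnd)" using P Q by (intro sum_mono add_mono) auto
  also have "\<dots> = 2 * real ?N * ?bnd" by simp
  also have "t^2 / 4 = r / (4 * real ?N)" unfolding t(3) by simp
  finally show ?thesis .
qed

subsection \<open>The instances\<close>

text \<open>The additive constant keeps the objective nonnegative in spite of the quadratic correction.\<close>

definition objective :: "nat \<Rightarrow> nat \<Rightarrow> real \<Rightarrow> real \<Rightarrow> real \<Rightarrow> (nat \<Rightarrow> nat) \<Rightarrow> nat set \<Rightarrow> real" where
  "objective K m k r l s S = absent K m s S (2 * K) + absent K m s S (Suc (2 * K))
     - blend (2 * K + 2) k r l (dispersion K) (asym_poly K) (sym_poly K) (absent K m s S)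
     + l * real (2 * K + 2)^2"

lemma objective_submodular:
  assumes D: "gradient (2 * K + 2) (blend (2 * K + 2) k r l (dispersion K) (asym_poly K) (sym_poly K)) D"
    and H: "\<forall>i<2 * K + 2. gradient (2 * K + 2) (D i) (H i)"
    and nn: "\<forall>x\<in>unit_cube (2 * K + 2). \<forall>i<2 * K + 2. \<forall>j<2 * K + 2. 0 \<le> H i j x"
  shows "submodular_on E (objective K m k r l s)"
  unfolding submodular_on_def
proof (intro allI impI)
  fix S T
  let ?a = "absent K m s"
  let ?f = "blend (2 * K + 2) k r l (dispersion K) (asym_poly K) (sym_poly K)"
  \<comment> \<open>\<open>absent\<close> is modular and antitone in the set, so
    \<open>S \<union> T\<close>, \<open>S\<close>, \<open>T\<close>, \<open>S \<inter> T\<close>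
    become the corners \<open>x\<close>, \<open>x + u\<close>, \<open>x + v\<close>,
    \<open>x + u + v\<close> of a parallelogram with nonnegative sides.\<close>
  let ?u = "\<lambda>i. ?a S i - ?a (S \<union> T) i" and ?v = "\<lambda>i. ?a T i - ?a (S \<union> T) i"
  have e1: "(\<lambda>i. ?a (S \<union> T) i + ?u i) = ?a S" and e2: "(\<lambda>i. ?a (S \<union> T) i + ?v i) = ?a T" by auto
  have e3: "(\<lambda>i. ?a (S \<union> T) i + ?u i + ?v i) = ?a (S \<inter> T)"
    using absent_modular[of K m s S T] by (auto simp: fun_eq_iff algebra_simps)
  have "?f (\<lambda>i. ?a (S \<union> T) i + ?u i) + ?f (\<lambda>i. ?a (S \<union> T) i + ?v i)
     \<le> ?f (?a (S \<union> T)) + ?f (\<lambda>i. ?a (S \<union> T) i + ?u i + ?v i)"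
  proof (rule supermodular_of_hessian_nonneg[OF D])
    show "gradient (2 * K + 2) (D i) (H i)" if "i < 2 * K + 2" for i using H that by blast
    show "0 \<le> H i j x" if "x \<in> unit_cube (2 * K + 2)" "i < 2 * K + 2" "j < 2 * K + 2" for x i j
      using nn that by blast
    show "?a (S \<union> T) \<in> unit_cube (2 * K + 2)" by (rule absent_unit_cube)
    show "(\<lambda>i. ?a (S \<union> T) i + ?u i + ?v i) \<in> unit_cube (2 * K + 2)"
      unfolding e3 by (rule absent_unit_cube)
    show "0 \<le> ?u i" "0 \<le> ?v i" for i by (auto intro: absent_antimono)
  qed
  then have "?f (?a S) + ?f (?a T) \<le> ?f (?a (S \<union> T)) + ?f (?a (S \<inter> T))"
    unfolding e1 e2 e3 .
  then show "objective K m k r l s (S \<union> T) + objective K m k r l s (S \<inter> T)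
      \<le> objective K m k r l s S + objective K m k r l s T"
    using absent_modular[of K m s S T "2 * K"] absent_modular[of K m s S T "Suc (2 * K)"]
    by (simp add: objective_def)
qed

text \<open>The upper bounds express that both cut functions, \<open>x a + x b\<close> minus the
  polynomial, are nonnegative.\<close>

lemma poly_bounds:
  assumes K: "0 < K" and x: "x \<in> unit_cube (2 * K + 2)"
  shows "0 \<le> asym_poly K x" "asym_poly K x \<le> x (2 * K) + x (Suc (2 * K))"
    and "0 \<le> sym_poly K x" "sym_poly K x \<le> x (2 * K) + x (Suc (2 * K))"
proof -
  define a b where "a = x (2 * K)" and "b = x (Suc (2 * K))"
  have x01: "0 \<le> x i" "x i \<le> 1" if "i < 2 * K + 2" for i using x that by (auto simp: unit_cube_def)
  have ab: "0 \<le> a" "a \<le> 1" "0 \<le> b" "b \<le> 1" using x01 by (auto simp: a_def b_def)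
  define p q where "p = (\<Prod>j<K. x j)" and "q = (\<Prod>j\<in>{K..<2*K}. x j)"
  have p: "0 \<le> p" "p \<le> 1" unfolding p_def using x01 by (auto intro!: prod_nonneg prod_le_1)
  have q: "0 \<le> q" "q \<le> 1" unfolding q_def using x01 by (auto intro!: prod_nonneg prod_le_1)
  define z where "z = ((\<Sum>j<2 * K. x j) / (2 * real K))^K"
  have "0 \<le> (\<Sum>j<2 * K. x j)" using x01 by (intro sum_nonneg) auto
  moreover have "(\<Sum>j<2 * K. x j) \<le> (\<Sum>j<2 * K. 1)" using x01 by (intro sum_mono) auto
  ultimately have z: "0 \<le> z" "z \<le> 1" unfolding z_def using K by (auto intro!: power_le_one)
  have F: "asym_poly K x = 7/20 * (p * a + q * b) + 13/10 * (a * b)"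
    by (simp add: asym_poly_def p_def q_def a_def b_def)
  have G: "sym_poly K x = 7/20 * (z * (a + b)) + 13/40 * ((a + b) * (a + b))"
    by (simp add: sym_poly_def z_def a_def b_def power2_eq_square)
  show "0 \<le> asym_poly K x" unfolding F using p q ab by simp
  show "0 \<le> sym_poly K x" unfolding G using z ab by simp
  have "p * a \<le> a" "q * b \<le> b" using p q ab by (auto simp: mult_left_le_one_le)
  moreover have "a * b \<le> a" "a * b \<le> b" using ab by (auto simp: mult_left_le mult_left_le_one_le)
  ultimately have "7/20 * (p * a + q * b) \<le> 7/20 * (a + b)" "13/10 * (a * b) \<le> 13/20 * (a + b)" by auto
  then have "asym_poly K x \<le> 7/20 * (a + b) + 13/20 * (a + b)"
    unfolding F by (rule add_mono)
  then show "asym_poly K x \<le> x (2 * K) + x (Suc (2 * K))"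
    by (simp add: a_def b_def field_simps)
  have "z * (a + b) \<le> a + b" using z ab by (intro mult_left_le_one_le) auto
  moreover have "(a + b) * (a + b) \<le> 2 * (a + b)" using ab by (intro mult_right_mono) auto
  ultimately have "sym_poly K x \<le> 7/20 * (a + b) + 13/40 * (2 * (a + b))"
    unfolding G by (intro add_mono mult_left_mono) auto
  then show "sym_poly K x \<le> x (2 * K) + x (Suc (2 * K))"
    by (simp add: a_def b_def field_simps)
qed

lemma total_bounds:
  assumes "x \<in> unit_cube N" shows "0 \<le> (\<Sum>i<N. x i)^2" "(\<Sum>i<N. x i)^2 \<le> real N^2"
proof -
  have "0 \<le> (\<Sum>i<N. x i)" using assms by (intro sum_nonneg) (auto simp: unit_cube_def)
  moreover have "(\<Sum>i<N. x i) \<le> (\<Sum>i<N. 1)" using assms by (intro sum_mono) (auto simp: unit_cube_def)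
  ultimately show "(\<Sum>i<N. x i)^2 \<le> real N^2" by (intro power_mono) auto
qed simp

lemma objective_bounds:
  assumes K: "0 < K" and r: "0 < r" and k: "0 < k" and l: "0 \<le> l"
  shows "0 \<le> objective K m k r l s S" "objective K m k r l s S \<le> 2 + l * real (2 * K + 2)^2"
proof -
  define x where "x = absent K m s S"
  have x: "x \<in> unit_cube (2 * K + 2)" unfolding x_def by (rule absent_unit_cube)
  define a b where "a = x (2 * K)" and "b = x (Suc (2 * K))"
  have ab: "0 \<le> a" "a \<le> 1" "0 \<le> b" "b \<le> 1" by (auto simp: x_def a_def b_def absent_bounds)
  define t where "t = cutoff k r (dispersion K x)"
  have t: "0 \<le> t" "t \<le> 1" using cutoff_bounds[OF r k] by (auto simp: t_def)
  define F G where "F = asym_poly K x" and "G = sym_poly K x"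
  have FG: "0 \<le> F" "F \<le> a + b" "0 \<le> G" "G \<le> a + b" using poly_bounds[OF K x] by (auto simp: F_def G_def a_def b_def)
  define T where "T = (\<Sum>i<2 * K + 2. x i)^2"
  have T: "0 \<le> l * T" "l * T \<le> l * real (2 * K + 2)^2"
    using total_bounds[OF x] l by (auto simp: T_def intro: mult_left_mono)
  have eq: "objective K m k r l s S = a + b - ((1 - t) * G + t * F) - l * T + l * real (2 * K + 2)^2"
    unfolding objective_def blend_def x_def[symmetric] a_def[symmetric] b_def[symmetric]
      t_def[symmetric] F_def[symmetric] G_def[symmetric] T_def[symmetric]
    by (simp add: algebra_simps)
  have "(1 - t) * G + t * F \<le> a + b" using convex_bound_le[OF FG(4) FG(2), of "1 - t" t] t by auto
  moreover have "0 \<le> (1 - t) * G + t * F" using t FG by simp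
  ultimately show "0 \<le> objective K m k r l s S" "objective K m k r l s S \<le> 2 + l * real (2 * K + 2)^2"
    unfolding eq using T ab by linarith+
qed

text \<open>The direct sum of a uniform matroid on the part in \<open>D\<close> and a free matroid
  on the rest.\<close>

lemma matroid_bounded_intersection:
  fixes E :: "'a set"
  assumes E: "finite E"
  shows "matroid E {S. S \<subseteq> E \<and> card (S \<inter> D) \<le> m}"
  unfolding matroid_def
proof (intro conjI allI impI)
  let ?I = "{S. S \<subseteq> E \<and> card (S \<inter> D) \<le> m}"
  show "S \<in> ?I" if "T \<in> ?I \<and> S \<subseteq> T" for S T
  proof -
    have "finite T" using that E finite_subset by blast
    then have "card (S \<inter> D) \<le> card (T \<inter> D)" using that by (intro card_mono) auto
    then show ?thesis using that by auto
  qed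
  fix S T assume ST: "S \<in> ?I \<and> T \<in> ?I \<and> card S < card T"
  have fin: "finite S" "finite T" using ST E finite_subset by blast+
  show "\<exists>x\<in>T - S. insert x S \<in> ?I"
  proof (cases "\<exists>x\<in>T - S. x \<notin> D")
    case True
    then obtain x where "x \<in> T - S" "x \<notin> D" by blast
    then show ?thesis using ST by (intro bexI[of _ x]) auto
  next
    \<comment> \<open>Every element of \<open>T - S\<close> lies in \<open>D\<close>, so
      \<open>S\<close> has fewer elements in \<open>D\<close> than \<open>T\<close> and any new
      element fits.\<close>
    case False
    have "\<not> T \<subseteq> S" using ST fin card_mono[of S T] by auto
    then obtain x where x: "x \<in> T - S" by blast
    have "T - D \<subseteq> S - D" using False by blast
    then have "card (T - D) \<le> card (S - D)" using fin by (intro card_mono) auto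
    moreover have "card A = card (A \<inter> D) + card (A - D)" if "finite A" for A
    proof -
      have "card ((A \<inter> D) \<union> (A - D)) = card (A \<inter> D) + card (A - D)"
        using that by (intro card_Un_disjoint) auto
      moreover have "(A \<inter> D) \<union> (A - D) = A" by blast
      ultimately show ?thesis by simp
    qed
    from this[OF fin(1)] this[OF fin(2)] have "card S = card (S \<inter> D) + card (S - D)"
      "card T = card (T \<inter> D) + card (T - D)" by auto
    ultimately have "card (S \<inter> D) < card (T \<inter> D)" using ST by linarith
    then have "card (insert x (S \<inter> D)) \<le> m" using ST fin x by auto
    moreover have "card (insert x S \<inter> D) \<le> card (insert x (S \<inter> D))" using fin by (intro card_mono) auto
    ultimately show ?thesis using ST x by (intro bexI[of _ x]) auto
  qed
qed (use E in auto)

text \<open>The elements of the roles \<open>a\<^sub>i, b\<^sub>i\<close>. Shifts map this set to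
  itself, so the matroid, which the algorithm is given, discloses nothing about them.\<close>

definition heavy :: "nat \<Rightarrow> nat \<Rightarrow> nat set" where
  "heavy K m = (\<lambda>(g, j). g * (2 * K + 2) + j) ` ({..<m} \<times> {..<2 * K})"

definition feasible :: "nat \<Rightarrow> nat \<Rightarrow> nat \<Rightarrow> nat set set" where
  "feasible K m n = {S. S \<subseteq> {..<n} \<and> card (S \<inter> heavy K m) \<le> m}"

lemma matroid_feasible: "matroid {..<n} (feasible K m n)"
  unfolding feasible_def by (rule matroid_bounded_intersection) simp

lemma feasible_finite: "finite (feasible K m n)"
  by (rule finite_subset[of _ "Pow {..<n}"]) (auto simp: feasible_def)

lemma sum_group_count:
  "(\<Sum>g<m. group_count K S g) = real (2 * K * m) - real (card (S \<inter> heavy K m))"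
proof -
  have inj: "inj_on (\<lambda>(g, j). g * (2 * K + 2) + j) ({..<m} \<times> {..<2 * K})"
  proof (rule inj_onI)
    fix a b
    assume a: "a \<in> {..<m} \<times> {..<2 * K}" and b: "b \<in> {..<m} \<times> {..<2 * K}"
      and e: "(case a of (g, j) \<Rightarrow> g * (2 * K + 2) + j) = (case b of (g, j) \<Rightarrow> g * (2 * K + 2) + j)"
    have "fst a = fst b \<and> snd a = snd b"
      by (rule group_slot_eq[of _ "2 * K + 2"]) (use a b e in \<open>auto simp: split_beta mem_Times_iff\<close>)
    then show "a = b" by (simp add: prod_eq_iff)
  qed
  have "real (card (S \<inter> heavy K m)) = (\<Sum>e\<in>heavy K m. of_bool (e \<in> S))"
    by (simp add: heavy_def of_bool_def sum.If_cases Int_commute Collect_mem_eq)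
  also have "\<dots> = (\<Sum>(g, j)\<in>{..<m} \<times> {..<2 * K}. of_bool (g * (2 * K + 2) + j \<in> S))"
    unfolding heavy_def sum.reindex[OF inj] by (intro sum.cong) auto
  also have "\<dots> = (\<Sum>g<m. \<Sum>j<2 * K. of_bool (g * (2 * K + 2) + j \<in> S))"
    by (rule sum.cartesian_product[symmetric])
  also have "\<dots> = (\<Sum>g<m. 2 * real K - group_count K S g)"
  proof (rule sum.cong)
    fix g
    have "(\<Sum>j<2 * K. of_bool (g * (2 * K + 2) + j \<in> S)) + group_count K S g = (\<Sum>j<2 * K. 1)"
      unfolding group_count_def sum.distrib[symmetric] by (intro sum.cong) auto
    then show "(\<Sum>j<2 * K. of_bool (g * (2 * K + 2) + j \<in> S)) = 2 * real K - group_count K S g" by simp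
  qed simp
  also have "\<dots> = real (2 * K * m) - (\<Sum>g<m. group_count K S g)" by (simp add: sum_subtractf)
  finally show ?thesis by simp
qed

text \<open>The threshold \<open>2K + 2\<close> is never exceeded by the dispersion, so the cutoff is zero throughout.\<close>

definition base_objective :: "nat \<Rightarrow> nat \<Rightarrow> real \<Rightarrow> real \<Rightarrow> nat set \<Rightarrow> real" where
  "base_objective K m k l = objective K m k (real (2 * K + 2)) l (\<lambda>_. 0)"

lemma dispersion_le:
  assumes "0 < K" "x \<in> unit_cube (2 * K + 2)"
  shows "dispersion K x \<le> real (2 * K + 2)"
proof -
  have "dispersion K x \<le> (\<Sum>i<2 * K + 2. 1)"
    unfolding dispersion_def
  proof (rule sum_mono)
    fix i assume "i \<in> {..<2 * K + 2}"
    then have "0 \<le> x i" "x i \<le> 1" "0 \<le> block_avg K x i" "block_avg K x i \<le> 1"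
      using assms(2) block_avg_unit_cube[OF assms] by (auto simp: unit_cube_def)
    then have "\<bar>x i - block_avg K x i\<bar> \<le> 1" by linarith
    then show "(x i - block_avg K x i)^2 \<le> 1" by (simp add: abs_square_le_1)
  qed
  then show ?thesis by simp
qed

text \<open>Up to the threshold the cutoff is zero, and the remaining terms depend on block sums
  only. These are the same for all shifts, so \<open>t\<close> is arbitrary.\<close>

lemma objective_eq_if_balanced:
  assumes K: "0 < K" and r: "dispersion K (absent K m s S) \<le> r"
  shows "objective K m k r l s S = absent K m t S (2 * K) + absent K m t S (Suc (2 * K))
     - sym_poly K (absent K m t S) - l * (\<Sum>i<2 * K + 2. absent K m t S i)^2 + l * real (2 * K + 2)^2"
proof -
  have a: "absent K m s S (2 * K) + absent K m s S (Suc (2 * K)) = absent K m t S (2 * K) + absent K m t S (Suc (2 * K))"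
    by (simp only: sum_absent_small_block)
  have b: "(\<Sum>i<2 * K. absent K m s S i) = (\<Sum>i<2 * K. absent K m t S i)"
    by (simp only: sum_absent_large_block[OF K])
  have c: "(\<Sum>i<2 * K + 2. absent K m s S i) = (\<Sum>i<2 * K + 2. absent K m t S i)"
    unfolding sum_two_blocks using a b by linarith
  have d: "sym_poly K (absent K m s S) = sym_poly K (absent K m t S)"
    unfolding sym_poly_def a b ..
  show ?thesis
    unfolding objective_def blend_def a c d using r by (simp add: cutoff_def)
qed

lemma objective_eq_base:
  assumes K: "0 < K" and r: "dispersion K (absent K m s S) \<le> r"
  shows "objective K m k r l s S = base_objective K m k l S"
  unfolding base_objective_def objective_eq_if_balanced[OF K r, of _ _ "\<lambda>_. 0"]
  by (rule objective_eq_if_balanced[symmetric]) (intro K dispersion_le absent_unit_cube)+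

text \<open>At most \<open>m\<close> heavy elements force the average over the large block up to
  \<open>1 - 1 / (2 * K)\<close>. What is left is a concave quadratic in \<open>t\<close>, whose
  maximum is the stated bound up to the correction.\<close>

lemma base_objective_le:
  assumes K: "0 < K" and m: "0 < m" and S: "S \<in> feasible K m n" and l: "0 \<le> l"
  shows "base_objective K m k l S \<le> 10/13 * (1 - 7/20 * (1 - 1 / (2 * real K))^K)^2 + l * real (2 * K + 2)^2"
proof -
  define x where "x = absent K m (\<lambda>_. 0) S"
  define t where "t = x (2 * K) + x (Suc (2 * K))"
  define z where "z = (\<Sum>j<2 * K. x j) / (2 * real K)"
  define q where "q = (1 - 1 / (2 * real K))^K"
  have x: "x \<in> unit_cube (2 * K + 2)" unfolding x_def by (rule absent_unit_cube)
  have t: "0 \<le> t" by (auto simp: t_def x_def absent_bounds)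
  have "2 * real K * real m - real m \<le> (\<Sum>g<m. group_count K S g)"
    using S by (simp add: sum_group_count feasible_def)
  then have "(2 * real K * real m - real m) / real m \<le> (\<Sum>j<2 * K. x j)"
    unfolding x_def sum_absent_large_block[OF K] by (intro divide_right_mono) auto
  moreover have "(2 * real K * real m - real m) / real m = 2 * real K - 1" using m by (simp add: field_simps)
  ultimately have "2 * real K - 1 \<le> (\<Sum>j<2 * K. x j)" by simp
  then have "(2 * real K - 1) / (2 * real K) \<le> z" unfolding z_def by (intro divide_right_mono) auto
  then have "1 - 1 / (2 * real K) \<le> z" using K by (simp add: field_simps)
  then have qz: "q \<le> z^K" unfolding q_def using K by (intro power_mono) (auto simp: field_simps)
  have "base_objective K m k l S = t - sym_poly K x - l * (\<Sum>i<2 * K + 2. x i)^2 + l * real (2 * K + 2)^2"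
    unfolding base_objective_def x_def t_def
    by (rule objective_eq_if_balanced) (intro K dispersion_le absent_unit_cube)+
  also have "sym_poly K x = 7/20 * (z^K * t) + 13/40 * t^2"
    by (simp add: sym_poly_def z_def t_def)
  finally have "base_objective K m k l S \<le> t - (7/20 * (z^K * t) + 13/40 * t^2) + l * real (2 * K + 2)^2"
    using total_bounds[OF x] l by (simp add: mult_nonneg_nonneg del: sum.lessThan_Suc)
  moreover have "q * t \<le> z^K * t" using qz t by (rule mult_right_mono)
  moreover have "t - 7/20 * (q * t) - 13/40 * t^2 \<le> 10/13 * (1 - 7/20 * q)^2"
  proof -
    \<comment> \<open>Completing the square: the maximizer is 20/13 times
      \<open>1 - 7/20 * q\<close>.\<close>
    have "0 \<le> (13 * t - 20 * (1 - 7/20 * q))^2" by simp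
    then show ?thesis by (simp add: power2_eq_square algebra_simps)
  qed
  ultimately show ?thesis unfolding q_def[symmetric] by linarith
qed

text \<open>The witness cuts the hyperedge into \<open>a\<close> and the edge \<open>ab\<close>, of
  total weight 7/20 + 13/20 = 1, so \<open>asym_poly\<close> vanishes there; as
  \<open>sym_poly\<close> is at most 1, the blend keeps at least the cutoff of this value.\<close>

lemma hidden_optimum:
  assumes K: "0 < K" and m: "0 < m" and n: "m * (2 * K + 2) \<le> n"
    and r: "0 < r" and k: "0 < k" and l: "0 \<le> l"
  obtains S where "S \<in> feasible K m n" "1/2 \<le> dispersion K (absent K m s S)"
    "cutoff k r (dispersion K (absent K m s S)) \<le> objective K m k r l s S"
proof
  let ?N = "2 * K + 2"
  \<comment> \<open>choose \<open>a\<^sub>1\<close> and \<open>b\<close> in every group\<close>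
  define A where "A = (\<lambda>g. g * ?N + slot K (s g) 0) ` {..<m}"
  define B where "B = (\<lambda>g. g * ?N + slot K (s g) (Suc (2 * K))) ` {..<m}"
  define S where "S = A \<union> B"
  have sl: "slot K v i < ?N" for v i using slot_less[OF K] .
  have lt: "g * ?N + slot K v i < n" if "g < m" for g v i
  proof -
    have "g * ?N + slot K v i < Suc g * ?N" using sl[of v i] by simp
    also have "\<dots> \<le> m * ?N" using that by (intro mult_right_mono) auto
    finally show ?thesis using n by linarith
  qed
  have "B \<inter> heavy K m = {}"
  proof (rule ccontr)
    assume "B \<inter> heavy K m \<noteq> {}"
    then obtain g h j where "j < 2 * K" and e: "g * ?N + slot K (s g) (Suc (2 * K)) = h * ?N + j"
      by (auto simp: B_def heavy_def)
    then have "slot K (s g) (Suc (2 * K)) = j" using group_slot_eq[OF sl _ e] by simp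
    then show False using \<open>j < 2 * K\<close> by (simp add: slot_def)
  qed
  then have "card (S \<inter> heavy K m) \<le> card A" unfolding S_def by (intro card_mono) (auto simp: A_def)
  also have "\<dots> \<le> m" unfolding A_def using card_image_le[of "{..<m}"] by fastforce
  finally show "S \<in> feasible K m n"
    using lt by (auto simp: feasible_def S_def A_def B_def)
  let ?x = "absent K m s S"
  have x0: "?x 0 = 0" and xb: "?x (Suc (2 * K)) = 0"
    by (auto simp: absent_def S_def A_def B_def)
  have "g * ?N + slot K (s g) (2 * K) \<notin> S" if "g < m" for g
  proof
    assume "g * ?N + slot K (s g) (2 * K) \<in> S"
    then obtain h i where e: "g * ?N + slot K (s g) (2 * K) = h * ?N + slot K (s h) i" and i: "i = 0 \<or> i = Suc (2 * K)"
      by (auto simp: S_def A_def B_def)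
    have "g = h \<and> slot K (s g) (2 * K) = slot K (s h) i" by (rule group_slot_eq[OF sl sl e])
    then have "slot K (s g) (2 * K) = slot K (s g) i" by metis
    from i show False
    proof
      assume "i = 0"
      moreover have "slot K (s g) 0 < 2 * K" "2 * K \<le> slot K (s g) (2 * K)" using K by (auto simp: slot_def)
      ultimately show False using \<open>slot K (s g) (2 * K) = slot K (s g) i\<close> by simp
    next
      assume "i = Suc (2 * K)"
      then show False using \<open>slot K (s g) (2 * K) = slot K (s g) i\<close>
        by (cases "even (s g)") (auto simp: slot_def even_iff_mod_2_eq_zero odd_iff_mod_2_eq_one mod_Suc)
    qed
  qed
  then have xa: "?x (2 * K) = 1" using m by (simp add: absent_def)
  have x: "?x \<in> unit_cube ?N" by (rule absent_unit_cube)
  \<comment> \<open>The last two coordinates, 1 and 0 with mean 1/2, already give dispersion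
    1/2.\<close>
  have "(\<Sum>i<2 * K. (?x i - block_avg K ?x i)^2) \<ge> 0" by (intro sum_nonneg) auto
  then show disp: "1/2 \<le> dispersion K ?x"
    unfolding dispersion_def sum_two_blocks using xa xb by (simp add: block_avg_def power2_eq_square)
  define t where "t = cutoff k r (dispersion K ?x)"
  have t: "0 \<le> t" "t \<le> 1" using cutoff_bounds[OF r k] by (auto simp: t_def)
  have "(\<Prod>j<K. ?x j) = 0" using x0 K by (intro prod_zero) auto
  then have F: "asym_poly K ?x = 0" using xb by (simp add: asym_poly_def)
  have G: "sym_poly K ?x \<le> 1" using poly_bounds(4)[OF K x] xa xb by simp
  have T: "l * (\<Sum>i<?N. ?x i)^2 \<le> l * real ?N^2" using total_bounds(2)[OF x] l by (rule mult_left_mono)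
  have "(1 - t) * sym_poly K ?x \<le> 1 - t" using G t by (intro mult_left_le) auto
  then have "t \<le> 1 - (sym_poly K ?x + t * (0 - sym_poly K ?x))" by (simp add: algebra_simps)
  then show "cutoff k r (dispersion K ?x) \<le> objective K m k r l s S"
    unfolding objective_def blend_def F xa xb t_def[symmetric] using T by linarith
qed

lemma cutoff_ge:
  assumes "0 < r" "r < 1/2" "0 < k" "1/2 \<le> y"
  shows "(1 - (2 * r) powr k)^3 \<le> cutoff k r y"
proof -
  have "r / y \<le> 2 * r" using assms by (simp add: field_simps)
  then have "(r / y) powr k \<le> (2 * r) powr k" using assms by (intro powr_mono2) auto
  moreover have "(2 * r) powr k \<le> 1" using assms by (intro powr_le1) auto
  ultimately show ?thesis using assms by (auto simp: cutoff_def intro!: power_mono)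
qed

section \<open>Indistinguishability for adaptive strategies\<close>

primrec visited :: "('a set \<Rightarrow> real) \<Rightarrow> 'a strategy \<Rightarrow> 'a set list" where
  "visited f (Return S) = [S]"
| "visited f (Query Q k) = Q # visited f (k (f Q))"

text \<open>The extra entry is the returned set, whose value must not betray the secret
  either.\<close>

lemma length_visited: "length (visited f t) = Suc (num_queries f t)"
  by (induction t) auto

lemma result_in_visited: "result f t \<in> set (visited f t)"
  by (induction t) auto

lemma result_cong_visited:
  "(\<And>Q. Q \<in> set (visited f t) \<Longrightarrow> g Q = f Q) \<Longrightarrow> result g t = result f t"
  by (induction t) auto

text \<open>Averaging over the secrets: runs against the fixed \<open>f\<close> visit at most
  \<open>q + 1\<close> sets, chosen independently of \<open>s\<close>, and each is bad for at most a
  fraction \<open>\<delta>\<close> of the secrets.\<close>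

lemma exists_rarely_visited:
  fixes \<Omega> :: "'i set"
  assumes \<Omega>: "finite \<Omega>" "\<Omega> \<noteq> {}"
    and rare: "\<And>Q. real (card {s \<in> \<Omega>. Q \<in> B s}) \<le> \<delta> * real (card \<Omega>)" and "0 \<le> \<delta>"
    and q: "\<And>t. t \<in> set_pmf P \<Longrightarrow> real (num_queries f t) \<le> q"
  shows "\<exists>s\<in>\<Omega>. measure_pmf.prob P {t. \<exists>Q\<in>set (visited f t). Q \<in> B s} \<le> (q + 1) * \<delta>"
proof (rule ccontr)
  let ?E = "\<lambda>s. {t. \<exists>Q\<in>set (visited f t). Q \<in> B s}"
  assume "\<not> ?thesis"
  then have "(\<Sum>s\<in>\<Omega>. (q + 1) * \<delta>) < (\<Sum>s\<in>\<Omega>. measure_pmf.prob P (?E s))"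
    using \<Omega> by (intro sum_strict_mono) auto
  also have "\<dots> = (\<Sum>s\<in>\<Omega>. measure_pmf.expectation P (indicator (?E s)))" by simp
  also have "\<dots> = measure_pmf.expectation P (\<lambda>t. \<Sum>s\<in>\<Omega>. indicator (?E s) t)"
    by (intro Bochner_Integration.integral_sum[symmetric] measure_pmf.integrable_const_bound[where B = 1]) auto
  also have "\<dots> \<le> (q + 1) * (\<delta> * real (card \<Omega>))"
  proof (rule measure_pmf.integral_le_const)
    show "integrable (measure_pmf P) (\<lambda>t. \<Sum>s\<in>\<Omega>. indicator (?E s) t :: real)"
      by (intro Bochner_Integration.integrable_sum measure_pmf.integrable_const_bound[where B = 1]) auto
    show "AE t in measure_pmf P. (\<Sum>s\<in>\<Omega>. indicator (?E s) t) \<le> (q + 1) * (\<delta> * real (card \<Omega>))"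
    proof (simp only: AE_measure_pmf_iff, rule ballI)
      fix t assume t: "t \<in> set_pmf P"
      let ?V = "set (visited f t)"
      have "(\<Sum>s\<in>\<Omega>. indicator (?E s) t) = real (card {s \<in> \<Omega>. t \<in> ?E s})"
        using \<Omega> by (simp add: indicator_def sum.If_cases Int_def)
      also have "{s \<in> \<Omega>. t \<in> ?E s} = (\<Union>Q\<in>?V. {s \<in> \<Omega>. Q \<in> B s})" by auto
      also have "real (card \<dots>) \<le> (\<Sum>Q\<in>?V. real (card {s \<in> \<Omega>. Q \<in> B s}))"
        unfolding of_nat_sum[symmetric] of_nat_le_iff by (rule card_UN_le) simp
      also have "\<dots> \<le> (\<Sum>Q\<in>?V. \<delta> * real (card \<Omega>))" by (intro sum_mono rare)
      also have "\<dots> = real (card ?V) * (\<delta> * real (card \<Omega>))" by simp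
      also have "\<dots> \<le> (q + 1) * (\<delta> * real (card \<Omega>))"
      proof (rule mult_right_mono)
        have "card ?V \<le> Suc (num_queries f t)" using card_length[of "visited f t"] by (simp add: length_visited)
        then show "real (card ?V) \<le> q + 1" using q[OF t] by linarith
      qed (use \<open>0 \<le> \<delta>\<close> in auto)
      finally show "(\<Sum>s\<in>\<Omega>. indicator (?E s) t) \<le> (q + 1) * (\<delta> * real (card \<Omega>))" .
    qed
  qed
  finally show False by (simp add: algebra_simps)
qed

text \<open>Unless a bad set is visited, the run against \<open>g s\<close> coincides with that
  against \<open>f\<close> and ends with value at most \<open>v\<close>. So the success probability
  is at most that of a bad visit, and the expected value exceeds \<open>v\<close> by at most
  \<open>M\<close> times it; the minimum covers both guarantees.\<close>

lemma hidden_family_hardness: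
  fixes \<Omega> :: "'i set"
  assumes \<Omega>: "finite \<Omega>" "\<Omega> \<noteq> {}"
    and rare: "\<And>Q. real (card {s \<in> \<Omega>. Q \<in> B s}) \<le> \<delta> * real (card \<Omega>)" and \<delta>: "0 \<le> \<delta>"
    and q: "\<And>t. t \<in> set_pmf (A \<I>) \<Longrightarrow> real (num_queries f t) \<le> q"
    and same: "\<And>s Q. s \<in> \<Omega> \<Longrightarrow> Q \<notin> B s \<Longrightarrow> g s Q = f Q"
    and low: "\<And>S. S \<in> \<I> \<Longrightarrow> f S \<le> v" and v: "0 \<le> v"
    and high: "\<And>s. s \<in> \<Omega> \<Longrightarrow> v + \<epsilon> \<le> \<alpha> * Max (g s ` \<I>)" and \<epsilon>: "0 < \<epsilon>"
    and bnd: "\<And>s S. s \<in> \<Omega> \<Longrightarrow> S \<in> \<I> \<Longrightarrow> 0 \<le> g s S \<and> g s S \<le> M" and M: "0 < M"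
    and approx: "(\<forall>s\<in>\<Omega>. approximates_with_prob p \<alpha> A (\<I>, g s)) \<or>
      (\<forall>s\<in>\<Omega>. approximates_in_expectation \<alpha> A (\<I>, g s))"
  shows "min p (\<epsilon> / M) \<le> (q + 1) * \<delta>"
proof -
  let ?P = "A \<I>"
  obtain s where s: "s \<in> \<Omega>" and "measure_pmf.prob ?P {t. \<exists>Q\<in>set (visited f t). Q \<in> B s} \<le> (q + 1) * \<delta>"
    using exists_rarely_visited[of \<Omega> B \<delta> ?P f q, OF \<Omega> rare \<delta> q] by blast
  define E where "E = {t. \<exists>Q\<in>set (visited f t). Q \<in> B s}"
  have E: "measure_pmf.prob ?P E \<le> (q + 1) * \<delta>" unfolding E_def by fact
  have val: "g s (result (g s) t) \<le> v" if "t \<notin> E" "result (g s) t \<in> \<I>" for t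
  proof -
    have nb: "\<And>Q. Q \<in> set (visited f t) \<Longrightarrow> Q \<notin> B s" using that by (auto simp: E_def)
    then have "result (g s) t = result f t" using same[OF s] by (intro result_cong_visited) auto
    moreover have "g s (result f t) = f (result f t)" by (intro same s nb result_in_visited)
    ultimately show ?thesis using low that by simp
  qed
  from approx show ?thesis
  proof
    assume "\<forall>s\<in>\<Omega>. approximates_with_prob p \<alpha> A (\<I>, g s)"
    then have "p \<le> measure_pmf.prob ?P {t. approx_solution \<alpha> (\<I>, g s) (result (g s) t)}"
      using s by (simp add: approximates_with_prob_def)
    also have "\<dots> \<le> measure_pmf.prob ?P E"
    proof (rule measure_pmf.finite_measure_mono)
      show "{t. approx_solution \<alpha> (\<I>, g s) (result (g s) t)} \<subseteq> E"
      proof (rule subsetI, rule ccontr)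
        fix t assume "t \<in> {t. approx_solution \<alpha> (\<I>, g s) (result (g s) t)}" "t \<notin> E"
        then have "\<alpha> * Max (g s ` \<I>) \<le> g s (result (g s) t)" "g s (result (g s) t) \<le> v"
          using val by (auto simp: approx_solution_def)
        then show False using high[OF s] \<epsilon> by linarith
      qed
    qed simp
    finally show ?thesis using E by linarith
  next
    assume "\<forall>s\<in>\<Omega>. approximates_in_expectation \<alpha> A (\<I>, g s)"
    then have feas: "\<And>t. t \<in> set_pmf ?P \<Longrightarrow> result (g s) t \<in> \<I>"
      and ex: "\<alpha> * Max (g s ` \<I>) \<le> measure_pmf.expectation ?P (\<lambda>t. g s (result (g s) t))"
      using s by (auto simp: approximates_in_expectation_def)
    have int: "integrable (measure_pmf ?P) (\<lambda>t. v + M * indicator E t)"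
      by (intro measure_pmf.integrable_const_bound[where B = "v + M"])
        (use v M in \<open>auto simp: AE_measure_pmf_iff indicator_def\<close>)
    have indE: "integrable (measure_pmf ?P) (indicator E :: _ \<Rightarrow> real)"
      by (intro measure_pmf.integrable_const_bound[where B = 1]) auto
    have "measure_pmf.expectation ?P (\<lambda>t. g s (result (g s) t)) \<le> measure_pmf.expectation ?P (\<lambda>t. v + M * indicator E t)"
    proof (rule integral_mono_AE)
      show "integrable (measure_pmf ?P) (\<lambda>t. g s (result (g s) t))"
        using feas bnd[OF s] by (intro measure_pmf.integrable_const_bound[where B = M]) (auto simp: AE_measure_pmf_iff)
      show "AE t in measure_pmf ?P. g s (result (g s) t) \<le> v + M * indicator E t"
        using feas bnd[OF s] val v by (auto simp: AE_measure_pmf_iff indicator_def intro: add_increasing)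
    qed (fact int)
    also have "\<dots> = v + M * measure_pmf.prob ?P E"
      using indE by (simp add: measure_pmf.prob_space)
    also have "\<dots> \<le> v + M * ((q + 1) * \<delta>)" using E M by simp
    finally have "\<epsilon> \<le> M * ((q + 1) * \<delta>)" using ex high[OF s] by linarith
    then have "\<epsilon> / M \<le> (q + 1) * \<delta>" using M by (simp add: divide_le_eq mult.commute)
    then show ?thesis by linarith
  qed
qed

subsection \<open>The query lower bound\<close>

text \<open>For 100 in the role of \<open>K\<close> the power is close enough to its limit
  \<open>exp (-1/2)\<close> to leave room below 0.478 for the error terms.\<close>

lemma symmetric_value_numeric: "10/13 * (1 - 7/20 * (1 - 1 / (2 * real 100))^100)^2 \<le> (0.4777::real)"
proof -
  have "(0.6057::real) \<le> (1 - 1 / (2 * real 100))^100" by (simp add: power_divide)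
  moreover have "(1 - 1 / (2 * real 100))^100 \<le> (1::real)" by (rule power_le_one) auto
  ultimately have "(1 - 7/20 * (1 - 1 / (2 * real 100))^100)^2 \<le> (1 - 7/20 * 0.6057 :: real)^2"
    by (intro power_mono) auto
  then show ?thesis by (simp add: power2_eq_square)
qed

theorem theoremE2:
  "\<exists>(C :: nat \<Rightarrow> nat problem set) (c :: real). c > 0 \<and>
     (\<forall>n. \<forall>i \<in> C n. submodular_matroid_instance {..<n} i) \<and>
     (\<forall>p > 0. \<exists>N. \<forall>n \<ge> N. \<forall>A. approximation_algorithm p 0.478 {..<n} (C n) A \<longrightarrow>
        (\<exists>(\<I>, f) \<in> C n. \<exists>t \<in> set_pmf (A \<I>). exp (c * real n) \<le> real (num_queries f t)))"
proof -
  define K :: nat where "K = 100"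
  define L where "L = 2 * K + 2"
  have K: "0 < K" and L: "0 < L" by (auto simp: K_def L_def)
  \<comment> \<open>The additive constant of the objectives becomes 1/10000, so base values stay
    within 0.4777 + 1/10000 = 0.4778.\<close>
  define l :: real where "l = 1 / (10000 * real L^2)"
  have l: "0 < l" using L by (simp add: l_def)
  have lL: "l * real (2 * K + 2)^2 = 1/10000" unfolding L_def[symmetric] using L by (simp add: l_def)
  obtain k where k: "0 < k" "k \<le> 1" and hess: "\<forall>r>0. \<exists>D H.
     gradient (2 * K + 2) (blend (2 * K + 2) k r l (dispersion K) (asym_poly K) (sym_poly K)) D \<and>
     (\<forall>i<2 * K + 2. gradient (2 * K + 2) (D i) (H i)) \<and>
     (\<forall>x\<in>unit_cube (2 * K + 2). \<forall>i<2 * K + 2. \<forall>j<2 * K + 2. 0 \<le> H i j x)"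
    using blend_supermodular_hessian[OF K l] by blast
  \<comment> \<open>Calibrated so that \<open>(2 * r) powr k\<close> is 3/100000. The hidden optimum
    is then at least 0.9999, and 0.478 * 0.9999 exceeds 0.4779.\<close>
  define r where "r = (3/100000) powr (1 / k) / 2"
  have "(3/100000) powr (1 / k) < (3/100000) powr (0::real)" using k by (intro powr_less_mono') auto
  then have r: "0 < r" "r < 1/2" by (auto simp: r_def)
  have rk: "(2 * r) powr k = 3/100000" using k by (simp add: r_def powr_powr)
  define shifts where "shifts m = {..<m} \<rightarrow>\<^sub>E {..<2 * K}" for m :: nat
  \<comment> \<open>Left-over elements are unconstrained and do not affect the objectives. The base
    instance belongs to the class because queries are counted on it.\<close>
  define C where "C n = (let m = n div L; \<I> = feasible K m n in if m = 0 then {} else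
    insert (\<I>, base_objective K m k l) ((\<lambda>s. (\<I>, objective K m k r l s)) ` shifts m))" for n
  \<comment> \<open>Half the decay rate of \<open>\<delta>\<close> per element, so that
    \<open>exp (c * n) * \<delta>\<close> still decays exponentially.\<close>
  define c where "c = r / (8 * real L^2)"
  have c: "0 < c" using r L by (simp add: c_def)
  have inst: "submodular_matroid_instance {..<n} (feasible K m n, objective K m k r' l s)" if "0 < r'" for r' s m n
  proof -
    have "nonneg_on {..<n} (objective K m k r' l s)"
      using objective_bounds(1)[OF K that k(1)] l by (simp add: nonneg_on_def)
    moreover have "submodular_on {..<n} (objective K m k r' l s)"
      using hess that objective_submodular by blast
    ultimately show ?thesis by (simp add: submodular_matroid_instance_def matroid_feasible)
  qed
  have "\<forall>n. \<forall>i\<in>C n. submodular_matroid_instance {..<n} i"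
    using inst[OF r(1)] inst[of "real (2 * K + 2)"]
    by (auto simp: C_def Let_def base_objective_def)
  moreover have "\<exists>N. \<forall>n\<ge>N. \<forall>A. approximation_algorithm p 0.478 {..<n} (C n) A \<longrightarrow>
        (\<exists>(\<I>, f) \<in> C n. \<exists>t \<in> set_pmf (A \<I>). exp (c * real n) \<le> real (num_queries f t))" if p: "0 < p" for p
  proof -
    \<comment> \<open>The bound of \<open>hidden_family_hardness\<close> for gap 1/10000 and values
      up to 3. Only the threshold \<open>N\<close> depends on \<open>p\<close>.\<close>
    define p' where "p' = min p ((1/10000) / 3)"
    have p': "0 < p'" using p by (simp add: p'_def)
    define B where "B = 4 * real L * exp (r / (4 * real L))"
    \<comment> \<open>At least \<open>L\<close>, for one full group; the other part makes
      \<open>p' * c * n\<close> at least \<open>B\<close>, which the exponential then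
      exceeds.\<close>
    define N where "N = max L (nat \<lceil>B / (p' * c)\<rceil>)"
    show ?thesis
    proof (intro exI[of _ N] allI impI, rule ccontr)
      fix n A
      assume n: "N \<le> n" and alg: "approximation_algorithm p 0.478 {..<n} (C n) A"
        and few: "\<not> (\<exists>(\<I>, f) \<in> C n. \<exists>t \<in> set_pmf (A \<I>). exp (c * real n) \<le> real (num_queries f t))"
      define m where "m = n div L"
      have m: "0 < m" using n L by (simp add: m_def N_def div_greater_zero_iff)
      have mn: "m * (2 * K + 2) \<le> n" unfolding m_def L_def[symmetric] by simp
      let ?I = "feasible K m n"
      have Cn: "C n = insert (?I, base_objective K m k l) ((\<lambda>s. (?I, objective K m k r l s)) ` shifts m)"
        using m by (simp add: C_def m_def[symmetric] Let_def)
      define \<delta> where "\<delta> = 2 * real L * exp (- (r / (4 * real L)) * real m)"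
      have cardS: "real (card (shifts m)) = real (2 * K) ^ m" by (simp add: shifts_def card_PiE)
      have "min p ((1/10000) / 3) \<le> (exp (c * real n) + 1) * \<delta>"
      proof (rule hidden_family_hardness[where \<Omega> = "shifts m" and A = A and \<I> = ?I
            and B = "\<lambda>s. {Q. r < dispersion K (absent K m s Q)}" and f = "base_objective K m k l"
            and g = "\<lambda>s. objective K m k r l s" and v = "0.4778" and \<alpha> = "0.478"])
        show "finite (shifts m)" by (auto simp: shifts_def intro: finite_PiE)
        show "shifts m \<noteq> {}" using K by (auto simp: shifts_def PiE_eq_empty_iff lessThan_empty_iff)
        show "real (card {s \<in> shifts m. Q \<in> {Q. r < dispersion K (absent K m s Q)}}) \<le> \<delta> * real (card (shifts m))" for Q
          using dispersion_count[OF K m r(1), of Q] r(2) unfolding cardS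
          by (simp add: shifts_def \<delta>_def L_def algebra_simps)
        show "0 \<le> \<delta>" by (simp add: \<delta>_def)
        show "real (num_queries (base_objective K m k l) t) \<le> exp (c * real n)" if "t \<in> set_pmf (A ?I)" for t
          using few that unfolding Cn by fastforce
        show "objective K m k r l s Q = base_objective K m k l Q"
          if "Q \<notin> {Q. r < dispersion K (absent K m s Q)}" for s Q
          using that by (intro objective_eq_base[OF K]) auto
        show "base_objective K m k l S \<le> 0.4778" if "S \<in> ?I" for S
          using base_objective_le[OF K m that, of l k] l lL symmetric_value_numeric
          by (simp add: K_def)
        show "0.4778 + 1/10000 \<le> 0.478 * Max ((\<lambda>S. objective K m k r l s S) ` ?I)" for s
        proof -
          obtain S where S: "S \<in> ?I" "1/2 \<le> dispersion K (absent K m s S)"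
            "cutoff k r (dispersion K (absent K m s S)) \<le> objective K m k r l s S"
            using hidden_optimum[OF K m mn r(1) k(1), of l s] l by auto
          have "(0.9999::real) \<le> (1 - 3/100000)^3" by (simp add: power3_eq_cube)
          also have "\<dots> \<le> cutoff k r (dispersion K (absent K m s S))"
            using cutoff_ge[OF r k(1) S(2)] by (simp add: rk)
          also have "\<dots> \<le> objective K m k r l s S" by (rule S(3))
          also have "\<dots> \<le> Max ((\<lambda>S. objective K m k r l s S) ` ?I)"
            using S(1) by (intro Max_ge finite_imageI feasible_finite) auto
          finally show ?thesis by simp
        qed
        show "0 \<le> objective K m k r l s S \<and> objective K m k r l s S \<le> 3" for s S
          using objective_bounds[OF K r(1) k(1), of l m s S] l lL by auto
        show "(\<forall>s\<in>shifts m. approximates_with_prob p 0.478 A (?I, \<lambda>S. objective K m k r l s S)) \<or>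
          (\<forall>s\<in>shifts m. approximates_in_expectation 0.478 A (?I, \<lambda>S. objective K m k r l s S))"
          using alg unfolding approximation_algorithm_def Cn by auto
      qed auto
      then have hard: "p' \<le> (exp (c * real n) + 1) * \<delta>" by (simp add: p'_def)
      \<comment> \<open>Rounding \<open>n\<close> down to full groups loses less than one group, at
        the cost of the constant factor \<open>exp (r / (4 * L))\<close>.\<close>
      have \<delta>_le: "\<delta> \<le> 2 * real L * exp (r / (4 * real L) - 2 * c * real n)"
      proof -
        have "n < (m + 1) * L" using L by (simp add: m_def dividend_less_div_times)
        then have "real n < real ((m + 1) * L)" by (simp only: of_nat_less_iff)
        then have "real n / real L \<le> real m + 1" using L by (simp add: pos_divide_le_eq distrib_right)
        then have "(r / (4 * real L)) * (real n / real L) \<le> (r / (4 * real L)) * (real m + 1)"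
          using r by (intro mult_left_mono) auto
        moreover have "(r / (4 * real L)) * (real n / real L) = 2 * c * real n"
          by (simp add: c_def power2_eq_square)
        ultimately have "- (r / (4 * real L)) * real m \<le> r / (4 * real L) - 2 * c * real n"
          by (simp add: algebra_simps add_divide_distrib)
        then show ?thesis unfolding \<delta>_def by (intro mult_left_mono) auto
      qed
      have "p' \<le> (exp (c * real n) + 1) * \<delta>" by (fact hard)
      also have "\<dots> \<le> (2 * exp (c * real n)) * \<delta>"
        using c by (intro mult_right_mono) (auto simp: \<delta>_def)
      also have "\<dots> \<le> 2 * exp (c * real n) * (2 * real L * exp (r / (4 * real L) - 2 * c * real n))"
        using \<delta>_le by (intro mult_left_mono) auto
      also have "\<dots> = B * exp (- (c * real n))"
      proof -
        have "exp (c * real n) * exp (r / (4 * real L) - 2 * c * real n) = exp (r / (4 * real L)) * exp (- (c * real n))"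
          unfolding exp_add[symmetric] by simp
        then show ?thesis by (simp add: B_def)
      qed
      finally have "p' * exp (c * real n) \<le> B" by (simp add: exp_minus field_simps)
      moreover have "B < p' * exp (c * real n)"
      proof -
        have "B / (p' * c) \<le> real N" unfolding N_def by linarith
        also have "\<dots> \<le> real n" using n by simp
        finally have "B \<le> p' * (c * real n)" using p' c by (simp add: pos_divide_le_eq mult_ac)
        also have "\<dots> < p' * exp (c * real n)"
          using p' exp_ge_add_one_self[of "c * real n"] by (intro mult_strict_left_mono) linarith+
        finally show ?thesis .
      qed
      ultimately show False by linarith
    qed
  qed
  ultimately show ?thesis using c by blast
qed


end
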